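(* Let $K$ be an algebraically closed field, and let $V\subset K^{n+2}$ be the simplicial toric variety attached to integers $d>1$, $a_1,\dots,a_n,b_1,\dots,b_n$ as described in the context. Suppose that the following conditions hold. (A) There are indices $i,j\in\{1,\dots,n\}$ such that $a_i=0$, $b_i\neq 0$, $a_j\neq 0$, $b_j=0$. (B) For all $i=1,\dots,n$: (i) $d\mid a_i\Leftrightarrow d\mid b_i$; (ii) $d\nmid a_i\Leftrightarrow \gcd(d,a_i)=1$, and $d\nmid b_i\Leftrightarrow\gcd(d,b_i)=1$. (C) In the matrix of residue classes modulo $d$ $$\begin{pmatrix}\bar a_1&\bar a_2&\cdots&\bar a_n\\ \bar b_1&\bar b_2&\cdots&\bar b_n\end{pmatrix}$$ the rows are proportional, i.e., one of them is an integer multiple of the other. (D) There is an index $i$ such that $\gcd(d,a_i)=1$. Let $p$ be any prime divisor of $d$. Then: (i) if $\operatorname{char}K\neq p$, then $\operatorname{ara}V=3$; (ii) if $d=p^r$ for some positive integer $r$, then $\operatorname{ara}V=2$ for $\operatorname{char}K=p$; in particular, $V$ is a set-theoretic complete intersection if and only if $\operatorname{char}K=p$.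
   Context: Setting: $n$ is a positive integer, $d$ is a positive integer, and $a_1,\dots,a_n,b_1,\dots,b_n$ are nonnegative integers such that for every index $i$ at least one of $a_i,b_i$ is nonzero, and $\gcd(d,a_1,\dots,a_n,b_1,\dots,b_n)=1$. The variety $V\subset K^{n+2}$ (coordinates $x_1,\dots,x_n,y_1,y_2$) is the set of all points $$x_i=u_i^d\ (i=1,\dots,n),\qquad y_1=u_1^{a_1}u_2^{a_2}\cdots u_n^{a_n},\qquad y_2=u_1^{b_1}u_2^{b_2}\cdots u_n^{b_n},\qquad (u_1,\dots,u_n)\in K^n.$$ It has codimension 2. The arithmetical rank $\operatorname{ara}V$ of an affine variety $V\subset K^N$ is the minimum number of polynomial equations (over $K$, in $N$ variables) whose common zero set in $K^N$ is $V$. One has $\operatorname{ara}V\ge\operatorname{codim}V$, and $V$ is called a set-theoretic complete intersection if equality holds (here: if $\operatorname{ara}V=2$). *)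

theory Defs
  imports
    "HOL-Library.Poly_Mapping"
    "HOL-Library.FuncSet"
    "HOL-Library.Extended_Nat"
    "HOL-Computational_Algebra.Computational_Algebra"
    "HOL-Number_Theory.Cong"
begin

section \<open>Algebraic sets in affine space\<close>

text \<open>Coordinates are numbered from 1 to \<open>N\<close>; points are extensional functions, so that two points
  are equal iff their \<open>N\<close> coordinates agree.\<close>

definition affine_space :: "nat \<Rightarrow> (nat \<Rightarrow> 'k) set" where
  "affine_space N = ({1..N} \<rightarrow>\<^sub>E UNIV)"

text \<open>A polynomial maps each monomial (exponent vector of finite support) to its coefficient.\<close>

type_synonym 'k mpoly = "(nat \<Rightarrow>\<^sub>0 nat) \<Rightarrow>\<^sub>0 'k"

definition mpoly_ring :: "nat \<Rightarrow> ('k::comm_ring_1) mpoly set" where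
  "mpoly_ring N = {f. \<forall>m \<in> Poly_Mapping.keys f. Poly_Mapping.keys m \<subseteq> {1..N}}"

definition eval_mpoly :: "(nat \<Rightarrow> 'k) \<Rightarrow> ('k::comm_ring_1) mpoly \<Rightarrow> 'k" where
  "eval_mpoly x f =
     (\<Sum>m \<in> Poly_Mapping.keys f. Poly_Mapping.lookup f m *
        (\<Prod>i \<in> Poly_Mapping.keys m. x i ^ Poly_Mapping.lookup m i))"

definition zero_set :: "nat \<Rightarrow> ('k::field) mpoly set \<Rightarrow> (nat \<Rightarrow> 'k) set" where
  "zero_set N F = {x \<in> affine_space N. \<forall>f \<in> F. eval_mpoly x f = 0}"

definition algebraic_set :: "nat \<Rightarrow> (nat \<Rightarrow> 'k::field) set \<Rightarrow> bool" where
  "algebraic_set N V \<longleftrightarrow> (\<exists>F \<subseteq> mpoly_ring N. V = zero_set N F)"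

definition irreducible_algebraic_set :: "nat \<Rightarrow> (nat \<Rightarrow> 'k::field) set \<Rightarrow> bool" where
  "irreducible_algebraic_set N Z \<longleftrightarrow>
     algebraic_set N Z \<and> Z \<noteq> {} \<and>
     (\<forall>A B. algebraic_set N A \<longrightarrow> algebraic_set N B \<longrightarrow> Z = A \<union> B \<longrightarrow> Z = A \<or> Z = B)"

text \<open>The (Krull) dimension of an algebraic set: the supremum of the lengths of strictly ascending
  chains of irreducible closed subsets.\<close>

definition alg_dim :: "nat \<Rightarrow> (nat \<Rightarrow> 'k::field) set \<Rightarrow> enat" where
  "alg_dim N V = Sup {enat k | k. \<exists>Z :: nat \<Rightarrow> (nat \<Rightarrow> 'k) set.
     (\<forall>i \<le> k. irreducible_algebraic_set N (Z i) \<and> Z i \<subseteq> V) \<and> (\<forall>i < k. Z i \<subset> Z (Suc i))}"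

definition alg_codim :: "nat \<Rightarrow> (nat \<Rightarrow> 'k::field) set \<Rightarrow> enat" where
  "alg_codim N V = enat N - alg_dim N V"

text \<open>With values in \<^typ>\<open>enat\<close>, the minimum is \<open>\<infinity>\<close> rather than a junk number should \<open>V\<close> not be cut
  out by finitely many polynomials; so any equation \<open>ara N V = 3\<close> includes that \<open>V\<close> is algebraic.\<close>

definition ara :: "nat \<Rightarrow> (nat \<Rightarrow> 'k::field) set \<Rightarrow> enat" where
  "ara N V = Inf {enat (card F) | F. finite F \<and> F \<subseteq> mpoly_ring N \<and> zero_set N F = V}"

definition set_theoretic_complete_intersection :: "nat \<Rightarrow> (nat \<Rightarrow> 'k::field) set \<Rightarrow> bool" where
  "set_theoretic_complete_intersection N V \<longleftrightarrow> ara N V = alg_codim N V"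


section \<open>Simplicial toric varieties of codimension 2\<close>

text \<open>The coordinates \<open>x\<^sub>1, \<dots>, x\<^sub>n, y\<^sub>1, y\<^sub>2\<close> have the numbers \<open>1, \<dots>, n, n + 1, n + 2\<close>.\<close>

definition simplicial_toric_variety ::
    "nat \<Rightarrow> nat \<Rightarrow> (nat \<Rightarrow> nat) \<Rightarrow> (nat \<Rightarrow> nat) \<Rightarrow> (nat \<Rightarrow> 'k::field) set" where
  "simplicial_toric_variety n d a b =
     {x \<in> affine_space (n + 2). \<exists>u \<in> affine_space n.
        (\<forall>i \<in> {1..n}. x i = u i ^ d) \<and>
        x (n + 1) = (\<Prod>i = 1..n. u i ^ a i) \<and>
        x (n + 2) = (\<Prod>i = 1..n. u i ^ b i)}"

definition proportional_rows_mod :: "nat \<Rightarrow> nat \<Rightarrow> (nat \<Rightarrow> nat) \<Rightarrow> (nat \<Rightarrow> nat) \<Rightarrow> bool" where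
  "proportional_rows_mod n d a b \<longleftrightarrow>
     (\<exists>c :: int. \<forall>i \<in> {1..n}. [int (b i) = c * int (a i)] (mod int d)) \<or>
     (\<exists>c :: int. \<forall>i \<in> {1..n}. [int (a i) = c * int (b i)] (mod int d))"

end

theory Submission
  imports Defs "Berlekamp_Zassenhaus.Unique_Factorization_Poly"
begin

text \<open>Since the rows are proportional modulo \<open>d\<close>, say \<open>b = c a + d e\<close> with \<open>e\<close> integral, \<open>V\<close> is cut out by
  \<open>y\<^sub>1^d = x^a\<close>, \<open>y\<^sub>2^d = x^b\<close> and the relation \<open>y\<^sub>2 = y\<^sub>1^c x^e\<close> cleared of denominators. If \<open>d\<close> is a power
  of the characteristic, \<open>d\<close>-th roots are unique and the first two equations suffice.

  If the characteristic is not \<open>p\<close>, there is a nontrivial \<open>d\<close>-th root of unity. By (A) the slice of \<open>V\<close>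
  where all \<open>x\<^sub>k\<close> but two are 1 is then a union of at least two surfaces
  \<open>y\<^sub>1 = \<eta>\<^sub>1 z^\<alpha>\<close>, \<open>y\<^sub>2 = \<eta>\<^sub>2 w^\<beta>\<close> in four-space, any two of which have only the origin in common. By
  Hartshorne's connectedness theorem such a union is not the zero set of two polynomials; here this is
  proved directly, from the Nullstellensatz and the regularity of the sequence \<open>F, G, z, w\<close>.

  The dimension of \<open>V\<close> is bounded above by noting that polynomials \<open>f\<^sub>i\<close> which vanish on the \<open>i\<close>-th
  member of a chain of irreducible sets, but not on the next, are algebraically independent.\<close>

section \<open>Nullstellensatz\<close>

text \<open>Conditions (A) and (B)(i) make the slice possible: \<open>a i = 0\<close> forces
  \<open>d dvd b i\<close>, and \<open>b j = 0\<close> forces \<open>d dvd a j\<close>, so each of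
  the two free parameters enters only one monomial, and only through its \<open>d\<close>-th power.
  The other parameters become \<open>d\<close>-th roots of unity. By (D) the first monomial can take
  a nontrivial value at them. The factor of proportionality is prime to \<open>d\<close>, so the
  values of the two monomials determine each other; distinct surfaces differ in both, which forces z
  = 0 and w = 0 at a common point. Two equations forbid this: a complete intersection of dimension
  two does not become disconnected when a point is removed.

  Variables are adjoined one at a time, as iterated univariate polynomials. Points are then found
  coordinate by coordinate, and setting w, then z, to 0 means taking the coefficient 0, so that
  regularity becomes a statement about constant coefficients.

  The exact dimension enters because a set-theoretic complete intersection is measured by the
  codimension.\<close>

definition ring_ideal :: "'a::comm_ring_1 set \<Rightarrow> bool" where
  "ring_ideal I \<longleftrightarrow> 0 \<in> I \<and> (\<forall>x\<in>I. \<forall>y\<in>I. x + y \<in> I) \<and> (\<forall>x\<in>I. \<forall>r. r * x \<in> I)"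

definition prime_ring_ideal :: "'a::comm_ring_1 set \<Rightarrow> bool" where
  "prime_ring_ideal Q \<longleftrightarrow>
     ring_ideal Q \<and> 1 \<notin> Q \<and> (\<forall>x y. x * y \<in> Q \<longrightarrow> x \<in> Q \<or> y \<in> Q)"

lemma ring_ideal_zero: "ring_ideal I \<Longrightarrow> 0 \<in> I"
  and ring_ideal_add: "ring_ideal I \<Longrightarrow> x \<in> I \<Longrightarrow> y \<in> I \<Longrightarrow> x + y \<in> I"
  and ring_ideal_mult: "ring_ideal I \<Longrightarrow> x \<in> I \<Longrightarrow> r * x \<in> I"
  by (auto simp: ring_ideal_def)

lemma prime_ring_ideal_imp_ideal: "prime_ring_ideal Q \<Longrightarrow> ring_ideal Q"
  and one_notin_prime_ring_ideal: "prime_ring_ideal Q \<Longrightarrow> 1 \<notin> Q"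
  by (simp_all add: prime_ring_ideal_def)

lemma ring_ideal_mult_right: "ring_ideal I \<Longrightarrow> x \<in> I \<Longrightarrow> x * r \<in> I"
  using ring_ideal_mult[of I x r] by (simp add: mult.commute)

lemma ring_ideal_diff: "ring_ideal I \<Longrightarrow> x \<in> I \<Longrightarrow> y \<in> I \<Longrightarrow> x - y \<in> I"
  using ring_ideal_add[of I x "- 1 * y"] ring_ideal_mult[of I y "- 1"] by simp

lemma prime_ring_ideal_power:
  assumes "prime_ring_ideal Q" "x ^ n \<in> Q"
  shows "x \<in> Q"
  using assms(2) by (induction n) (use assms(1) in \<open>auto simp: prime_ring_ideal_def\<close>)

text \<open>An ideal that is maximal among those containing \<open>I\<close> and missing all powers
  of \<open>h\<close> is prime: adjoining an outside element captures a power of \<open>h\<close>,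
  and the product of two such powers would lie in the ideal as soon as the product of the two
  elements does.\<close>

lemma prime_ring_ideal_avoiding_powers:
  assumes I: "ring_ideal I" and h: "\<And>n. h ^ n \<notin> I"
  obtains Q where "prime_ring_ideal Q" "I \<subseteq> Q" "h \<notin> Q"
proof -
  define A where "A = {J. ring_ideal J \<and> I \<subseteq> J \<and> (\<forall>n. h ^ n \<notin> J)}"
  have "\<exists>M\<in>A. \<forall>X\<in>A. M \<subseteq> X \<longrightarrow> X = M"
  proof (rule subset_Zorn_nonempty)
    show "A \<noteq> {}" using I h by (auto simp: A_def)
  next
    fix C assume C: "C \<noteq> {}" "subset.chain A C"
    have CA: "C \<subseteq> A" and tot: "\<And>X Y. X \<in> C \<Longrightarrow> Y \<in> C \<Longrightarrow> X \<subseteq> Y \<or> Y \<subseteq> X"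
      using C(2) by (auto simp: subset.chain_def)
    have add: "x + y \<in> \<Union>C" if xy: "x \<in> \<Union>C" "y \<in> \<Union>C" for x y
    proof -
      from xy obtain X Y where XY: "X \<in> C" "Y \<in> C" "x \<in> X" "y \<in> Y" by auto
      then obtain Z where "Z \<in> C" "x \<in> Z" "y \<in> Z" using tot by blast
      moreover have "ring_ideal Z" using \<open>Z \<in> C\<close> CA by (auto simp: A_def)
      ultimately show ?thesis using ring_ideal_add by blast
    qed
    have mem: "0 \<in> X" "I \<subseteq> X" "\<forall>n. h ^ n \<notin> X" "x \<in> X \<Longrightarrow> r * x \<in> X"
      if "X \<in> C" for X x r
    proof -
      have "ring_ideal X" using that CA by (auto simp: A_def)
      then show "0 \<in> X" "x \<in> X \<Longrightarrow> r * x \<in> X" by (rule ring_ideal_zero, rule ring_ideal_mult)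
      show "I \<subseteq> X" "\<forall>n. h ^ n \<notin> X" using that CA by (auto simp: A_def)
    qed
    have "r * x \<in> \<Union>C" if "x \<in> \<Union>C" for r x using that mem(4) by blast
    moreover have "0 \<in> \<Union>C" "I \<subseteq> \<Union>C" using C(1) mem(1,2) by blast+
    moreover have "\<forall>n. h ^ n \<notin> \<Union>C" using mem(3) by blast
    ultimately show "\<Union>C \<in> A" using add by (simp add: A_def ring_ideal_def)
  qed
  then obtain M where M: "M \<in> A" "\<And>X. X \<in> A \<Longrightarrow> M \<subseteq> X \<Longrightarrow> X = M" by blast
  have iM: "ring_ideal M" and IM: "I \<subseteq> M" and hM: "\<And>n. h ^ n \<notin> M"
    using M(1) by (auto simp: A_def)
  have key: "\<exists>n r m. m \<in> M \<and> h ^ n = m + r * x" if x: "x \<notin> M" for x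
  proof -
    let ?N = "{m + r * x | m r. m \<in> M}"
    have iN: "ring_ideal ?N"
      unfolding ring_ideal_def
    proof (intro conjI ballI allI)
      have "0 = 0 + 0 * x" by simp
      then show "0 \<in> ?N" using ring_ideal_zero[OF iM] by blast
    next
      fix u v assume "u \<in> ?N" "v \<in> ?N"
      then obtain m r m' r' where "u = m + r * x" "v = m' + r' * x" "m \<in> M" "m' \<in> M" by blast
      then have "u + v = (m + m') + (r + r') * x \<and> m + m' \<in> M"
        using ring_ideal_add[OF iM] by (simp add: algebra_simps)
      then show "u + v \<in> ?N" by blast
    next
      fix u s assume "u \<in> ?N"
      then obtain m r where "u = m + r * x" "m \<in> M" by blast
      then have "s * u = s * m + (s * r) * x \<and> s * m \<in> M"
        using ring_ideal_mult[OF iM] by (simp add: algebra_simps)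
      then show "s * u \<in> ?N" by blast
    qed
    have "m = m + 0 * x" for m by simp
    then have MN: "M \<subseteq> ?N" by blast
    have "x = 0 + 1 * x" "0 \<in> M" using ring_ideal_zero[OF iM] by auto
    then have "x \<in> ?N" by blast
    then have "?N \<notin> A" using M(2)[OF _ MN] x by blast
    then obtain n where "h ^ n \<in> ?N" using iN MN IM by (auto simp: A_def)
    then show ?thesis by blast
  qed
  have "x \<in> M \<or> y \<in> M" if xy: "x * y \<in> M" for x y
  proof (rule ccontr)
    assume "\<not> ?thesis"
    then obtain n r m n' r' m' where *: "m \<in> M" "h ^ n = m + r * x" "m' \<in> M" "h ^ n' = m' + r' * y"
      using key by meson
    have "h ^ (n + n') = (m' + r' * y) * m + (r * x) * m' + (r * r') * (x * y)"
      by (simp add: power_add * algebra_simps)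
    also have "\<dots> \<in> M"
      using iM *(1,3) xy by (simp add: ring_ideal_add ring_ideal_mult)
    finally show False using hM by blast
  qed
  moreover have "1 \<notin> M" using hM[of 0] by simp
  moreover have "h \<notin> M" using hM[of 1] by simp
  ultimately show ?thesis using that[of M] iM IM by (auto simp: prime_ring_ideal_def)
qed

section \<open>Zeros of a prime ideal, one variable at a time\<close>

lemma prime_ring_ideal_contract:
  "prime_ring_ideal Q \<Longrightarrow> prime_ring_ideal {b. [:b:] \<in> Q}"
proof -
  assume Q: "prime_ring_ideal Q"
  have sum: "[:a + b:] = [:a:] + [:b:]" and prod: "[:a * b:] = [:a:] * [:b:]" for a b :: 'a
    by simp_all
  show ?thesis
    using Q unfolding prime_ring_ideal_def ring_ideal_def mem_Collect_eq sum prod one_pCons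
    by (simp add: pCons_0_0 del: mult_pCons_left mult_pCons_right add_pCons)
qed

lemma ring_ideal_poly_coeffs:
  assumes "ring_ideal Q" "\<And>i. [:coeff f i:] \<in> Q"
  shows "f \<in> Q"
  using assms(2)
proof (induction f)
  case 0
  then show ?case using assms(1) by (simp add: ring_ideal_zero)
next
  case (pCons a p)
  have "[:coeff p i:] \<in> Q" for i using pCons.prems[of "Suc i"] by simp
  then have "[:0, 1:] * p \<in> Q" using pCons.IH assms(1) by (simp add: ring_ideal_mult del: mult_pCons_left)
  moreover have "[:a:] \<in> Q" using pCons.prems[of 0] by simp
  ultimately have "[:a:] + [:0, 1:] * p \<in> Q" by (rule ring_ideal_add[OF assms(1), rotated])
  then show ?case by simp
qed

lemma comm_ring_hom_poly_map_poly:
  assumes "comm_ring_hom \<phi>"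
  shows "comm_ring_hom (\<lambda>f. poly (map_poly \<phi> f) c)"
proof -
  interpret comm_ring_hom \<phi> by fact
  interpret m: map_poly_comm_ring_hom \<phi> ..
  show ?thesis by unfold_locales (auto simp: hom_distribs)
qed

text \<open>Over an algebraically closed field \<open>g\<close> splits into \<open>degree g\<close>
  linear factors, and each of them divides \<open>h\<close>.\<close>

lemma dvd_power_degree_if_roots:
  fixes g h :: "'k::alg_closed_field poly"
  assumes "g \<noteq> 0" "\<And>c. poly g c = 0 \<Longrightarrow> poly h c = 0"
  shows "g dvd h ^ degree g"
proof -
  obtain A where A: "size A = degree g" "g = smult (lead_coeff g) (\<Prod>x\<in>#A. [:-x, 1:])"
    using alg_closed_imp_factorization[OF assms(1)] by blast
  have "[:-x, 1:] dvd h" if "x \<in># A" for x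
  proof -
    have "[:-x, 1:] dvd (\<Prod>x\<in>#A. [:-x, 1:])" using that by (simp add: dvd_prod_mset)
    then have "[:-x, 1:] dvd g" by (subst A(2)) (rule dvd_smult)
    then show ?thesis using assms(2) by (simp add: poly_eq_0_iff_dvd)
  qed
  then have "(\<Prod>x\<in>#A. [:-x, 1:]) dvd h ^ size A"
    by (induction A) (auto intro!: mult_dvd_mono simp del: mult_pCons_left)
  then show ?thesis using A assms(1) by (metis leading_coeff_0_iff smult_dvd_iff)
qed

lemma infinite_UNIV_alg_closed: "infinite (UNIV :: 'k::alg_closed_field set)"
proof
  assume fin: "finite (UNIV :: 'k set)"
  define p where "p = (\<Prod>a\<in>UNIV. [:-a, 1:] :: 'k poly)"
  have "degree p = card (UNIV :: 'k set)"
    unfolding p_def by (subst degree_prod_eq_sum_degree) auto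
  also have "\<dots> > 0" using fin by (simp add: card_gt_0_iff)
  finally have "degree (p + 1) > 0" by (simp add: degree_add_eq_left)
  then obtain x where "poly (p + 1) x = 0" using alg_closed_imp_poly_has_root by blast
  moreover have "poly p x = 0" using fin by (auto simp: p_def poly_prod)
  ultimately show False by simp
qed

lemma poly_eq_0_if_cofinitely:
  fixes p :: "'k::alg_closed_field poly"
  assumes "finite A" "\<And>x. x \<notin> A \<Longrightarrow> poly p x = 0"
  shows "p = 0"
proof (rule ccontr)
  assume "p \<noteq> 0"
  then have "finite (A \<union> {x. poly p x = 0})" using assms(1) by (simp add: poly_roots_finite)
  moreover have "A \<union> {x. poly p x = 0} = UNIV" using assms(2) by auto
  ultimately show False using infinite_UNIV_alg_closed by metis
qed

text \<open>The elimination step of the Nullstellensatz: a zero of the contracted prime extends by a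
  value \<open>c\<close> of the new variable, with \<open>h\<close> still nonzero, provided that a
  single element \<open>a\<close> of the base ring does not vanish. The quantifier over
  \<open>\<phi>\<close> comes after \<open>a\<close>, so that \<open>a\<close> can serve as the new
  \<open>h\<close> one level below.\<close>

lemma prime_ideal_poly_extend_hom:
  fixes Q :: "'a::idom poly set"
  assumes Q: "prime_ring_ideal Q" and h: "h \<notin> Q"
  obtains a where "[:a:] \<notin> Q"
    "\<forall>\<phi> :: 'a \<Rightarrow> 'k::alg_closed_field. comm_ring_hom \<phi> \<and> (\<forall>b. [:b:] \<in> Q \<longrightarrow> \<phi> b = 0) \<and>
      \<phi> a \<noteq> 0 \<longrightarrow> (\<exists>c. (\<forall>f\<in>Q. poly (map_poly \<phi> f) c = 0) \<and> poly (map_poly \<phi> h) c \<noteq> 0)"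
proof -
  have iQ: "ring_ideal Q" and Q1: "1 \<notin> Q" and pQ: "\<And>x y. x * y \<in> Q \<Longrightarrow> x \<in> Q \<or> y \<in> Q"
    using Q by (auto simp: prime_ring_ideal_def)
  have ne: "\<exists>i. [:coeff f i:] \<notin> Q" if "f \<notin> Q" for f
    using ring_ideal_poly_coeffs[OF iQ] that by blast
  have map0: "map_poly \<phi> f = 0"
    if "comm_ring_hom \<phi>" "\<And>b. [:b:] \<in> Q \<Longrightarrow> \<phi> b = 0" "\<And>i. [:coeff f i:] \<in> Q"
    for f and \<phi> :: "'a \<Rightarrow> 'k"
  proof -
    interpret comm_ring_hom \<phi> by fact
    show ?thesis using that(2,3) by (intro poly_eqI) simp
  qed
  show ?thesis
  proof (cases "\<forall>f\<in>Q. \<forall>i. [:coeff f i:] \<in> Q")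
    case True
    \<comment> \<open>Here \<open>Q\<close> is generated by its constants, so every \<open>c\<close>
      is a zero of \<open>Q\<close>; a coefficient of \<open>h\<close> outside \<open>Q\<close>
      keeps the image of \<open>h\<close> from being the zero polynomial.\<close>
    obtain i where i: "[:coeff h i:] \<notin> Q" using ne[OF h] by blast
    show ?thesis
    proof (rule that[OF i], intro allI impI, elim conjE)
      fix \<phi> :: "'a \<Rightarrow> 'k"
      assume \<phi>': "\<forall>b. [:b:] \<in> Q \<longrightarrow> \<phi> b = 0"
      assume \<phi>1: "comm_ring_hom \<phi>" and \<phi>3: "\<phi> (coeff h i) \<noteq> 0"
      note \<phi> = \<phi>1 \<phi>'[rule_format] \<phi>3
      interpret comm_ring_hom \<phi> by fact
      have "map_poly \<phi> h \<noteq> 0" using \<phi>(3) by (metis coeff_map_poly_hom coeff_0)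
      then obtain c where "poly (map_poly \<phi> h) c \<noteq> 0"
        using poly_eq_0_if_cofinitely[of "{}"] by blast
      then show "\<exists>c. (\<forall>f\<in>Q. poly (map_poly \<phi> f) c = 0) \<and> poly (map_poly \<phi> h) c \<noteq> 0"
        using map0[OF \<phi>(1,2)] True by (intro exI[of _ c]) auto
    qed
  next
    case False
    \<comment> \<open>A member \<open>g\<close> of least degree whose coefficients do not all lie in
      \<open>Q\<close>. Members of \<open>Q\<close> of smaller degree are mapped to 0 by every
      admissible \<open>\<phi>\<close>, and so are the remainders that members of \<open>Q\<close>
      leave modulo \<open>g\<close>.\<close>
    define P where "P = (\<lambda>f. f \<in> Q \<and> (\<exists>i. [:coeff f i:] \<notin> Q))"
    from False obtain f0 where "P f0" by (auto simp: P_def)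
    from ex_has_least_nat[of P, OF this, of degree]
    obtain g where g: "P g" and gmin: "\<And>f. P f \<Longrightarrow> degree g \<le> degree f" by blast
    have low: "[:coeff f i:] \<in> Q" if "f \<in> Q" "f = 0 \<or> degree f < degree g" for f i
      using gmin[of f] that ring_ideal_zero[OF iQ] by (auto simp: P_def dest: leD)
    from g obtain i0 where gQ: "g \<in> Q" and i0: "[:coeff g i0:] \<notin> Q" by (auto simp: P_def)
    define l where "l = lead_coeff g"
    define D where "D = degree g"
    have l: "[:l:] \<notin> Q"
    proof
      assume lQ: "[:l:] \<in> Q"
      \<comment> \<open>Without its leading term, \<open>g\<close> would be a member of smaller
        degree whose coefficient at \<open>i0\<close> is still outside \<open>Q\<close>.\<close>
      let ?f = "g - monom l D"
      have "monom l D = monom 1 D * [:l:]" by (simp add: smult_monom)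
      then have fQ: "?f \<in> Q" using gQ lQ ring_ideal_diff[OF iQ] ring_ideal_mult[OF iQ] by metis
      have i0D: "i0 \<noteq> D" using lQ i0 by (auto simp: l_def D_def)
      have "i0 \<le> D" using i0 ring_ideal_zero[OF iQ] unfolding D_def
        by (metis le_degree pCons_0_0)
      then have "D > 0" using i0D by auto
      have "degree ?f < D"
      proof (rule degree_lessI)
        show "?f \<noteq> 0 \<or> D > 0" using \<open>D > 0\<close> by simp
        show "\<forall>k\<ge>D. coeff ?f k = 0"
          by (auto simp: D_def l_def coeff_eq_0)
      qed
      then have "[:coeff ?f i0:] \<in> Q" using low[OF fQ] by (simp add: D_def)
      then show False using i0 i0D by simp
    qed
    have g0: "g \<noteq> 0" using l ring_ideal_zero[OF iQ] by (auto simp: l_def)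
    have lp: "[:l ^ k:] \<notin> Q" for k
      using prime_ring_ideal_power[OF Q, of "[:l:]" k] l by (auto simp: poly_const_pow)
    have pdiv: "\<exists>k q r. smult (l ^ k) f = g * q + r \<and> (r = 0 \<or> degree r < degree g)" for f
      using pseudo_divmod[OF g0, of f] by (cases "pseudo_divmod f g") (auto simp: l_def)
    \<comment> \<open>Division of \<open>h ^ D\<close> instead of \<open>h\<close>: if every root of
      the image of \<open>g\<close> were a root of that of \<open>h\<close>, the image of
      \<open>g\<close> would divide that of \<open>h ^ D\<close>, hence the remainder, which has
      smaller degree.\<close>
    obtain k q r where r: "smult (l ^ k) (h ^ D) = g * q + r" "r = 0 \<or> degree r < degree g"
      using pdiv by blast
    have rQ: "r \<notin> Q"
    proof
      assume "r \<in> Q"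
      then have "[:l ^ k:] * h ^ D \<in> Q"
        using r(1) gQ ring_ideal_add[OF iQ] ring_ideal_mult_right[OF iQ] by simp
      then have "h ^ D \<in> Q" using pQ lp by blast
      then show False using prime_ring_ideal_power[OF Q] h by blast
    qed
    then obtain i where i: "[:coeff r i:] \<notin> Q" using ne by blast
    have "[:l:] * [:coeff r i:] \<notin> Q" using pQ l i by blast
    \<comment> \<open>The factor \<open>l\<close> preserves the degree of \<open>g\<close> under
      \<open>\<phi>\<close>; the coefficient of \<open>r\<close> keeps the remainder
      nonzero.\<close>
    then have a: "[:l * coeff r i:] \<notin> Q" by (simp add: mult.commute)
    show ?thesis
    proof (rule that[OF a], intro allI impI, elim conjE)
      fix \<phi> :: "'a \<Rightarrow> 'k"
      assume \<phi>': "\<forall>b. [:b:] \<in> Q \<longrightarrow> \<phi> b = 0"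
      assume \<phi>1: "comm_ring_hom \<phi>" and \<phi>3: "\<phi> (l * coeff r i) \<noteq> 0"
      note \<phi> = \<phi>1 \<phi>'[rule_format] \<phi>3
      interpret comm_ring_hom \<phi> by fact
      interpret m: map_poly_comm_ring_hom \<phi> ..
      let ?m = "map_poly \<phi>"
      have \<phi>l: "\<phi> l \<noteq> 0" and \<phi>r: "\<phi> (coeff r i) \<noteq> 0" using \<phi>(3) by (auto simp: hom_mult)
      have "coeff (?m g) D \<noteq> 0" using \<phi>l by (simp add: l_def D_def)
      then have mg0: "?m g \<noteq> 0" by (metis coeff_0)
      have dg: "degree (?m g) = D"
        using \<open>coeff (?m g) D \<noteq> 0\<close> degree_map_poly_le[of \<phi> g] le_degree[of "?m g" D]
        by (simp add: D_def)
      have sm: "?m (smult b f) = smult (\<phi> b) (?m f)" for b f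
        by (intro poly_eqI) (simp add: hom_mult)
      have "\<exists>c. poly (?m g) c = 0 \<and> poly (?m h) c \<noteq> 0"
      proof (rule ccontr)
        assume "\<not> ?thesis"
        then have "?m g dvd ?m h ^ D"
          using dvd_power_degree_if_roots[OF mg0, of "?m h"] dg by auto
        then have "?m g dvd smult (\<phi> (l ^ k)) (?m h ^ D)" by (rule dvd_smult)
        also have "smult (\<phi> (l ^ k)) (?m h ^ D) = ?m g * ?m q + ?m r"
          using arg_cong[OF r(1), of ?m] by (simp add: sm m.hom_power m.hom_add m.hom_mult)
        finally have "?m g dvd ?m r" by (simp add: dvd_add_right_iff)
        moreover have "?m r \<noteq> 0" using \<phi>r by (metis coeff_map_poly_hom coeff_0)
        ultimately have "D \<le> degree (?m r)" using dg dvd_imp_degree_le by blast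
        also have "\<dots> \<le> degree r" by (rule degree_map_poly_le)
        finally show False using r(2) \<open>?m r \<noteq> 0\<close> by (auto simp: D_def)
      qed
      then obtain c where c: "poly (?m g) c = 0" "poly (?m h) c \<noteq> 0" by blast
      have "poly (?m f) c = 0" if f: "f \<in> Q" for f
      proof -
        obtain k' q' r' where r': "smult (l ^ k') f = g * q' + r'" "r' = 0 \<or> degree r' < degree g"
          using pdiv by blast
        have "r' = [:l ^ k':] * f - g * q'" using r'(1) by simp
        also have "\<dots> \<in> Q"
          using f gQ by (intro ring_ideal_diff[OF iQ] ring_ideal_mult[OF iQ] ring_ideal_mult_right[OF iQ])
        finally have "?m r' = 0" using low[OF _ r'(2)] by (intro map0[OF \<phi>(1,2)])
        then have "smult (\<phi> (l ^ k')) (?m f) = ?m g * ?m q'"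
          using arg_cong[OF r'(1), of ?m] by (simp add: sm m.hom_add m.hom_mult)
        then have "\<phi> l ^ k' * poly (?m f) c = poly (?m g * ?m q') c"
          by (metis poly_smult hom_power)
        then show ?thesis using c(1) \<phi>l by simp
      qed
      then show "\<exists>c. (\<forall>f\<in>Q. poly (?m f) c = 0) \<and> poly (?m h) c \<noteq> 0" using c(2) by blast
    qed
  qed
qed

section \<open>Nullstellensatz in four variables\<close>

abbreviation eval2 :: "'k::comm_ring_1 \<Rightarrow> 'k \<Rightarrow> 'k poly poly \<Rightarrow> 'k" where
  "eval2 y1 y2 f \<equiv> poly (map_poly (\<lambda>f. poly f y1) f) y2"

abbreviation eval3 :: "'k::comm_ring_1 \<Rightarrow> 'k \<Rightarrow> 'k \<Rightarrow> 'k poly poly poly \<Rightarrow> 'k" where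
  "eval3 y1 y2 z f \<equiv> poly (map_poly (eval2 y1 y2) f) z"

abbreviation eval4 :: "'k::comm_ring_1 \<Rightarrow> 'k \<Rightarrow> 'k \<Rightarrow> 'k \<Rightarrow> 'k poly poly poly poly \<Rightarrow> 'k" where
  "eval4 y1 y2 z w f \<equiv> poly (map_poly (eval3 y1 y2 z) f) w"

lemma comm_ring_hom_eval:
  "comm_ring_hom (\<lambda>f. poly f y1)" "comm_ring_hom (eval2 y1 y2)"
  "comm_ring_hom (eval3 y1 y2 z)" "comm_ring_hom (eval4 y1 y2 z w)"
proof -
  show *: "comm_ring_hom (\<lambda>f. poly f y1)" by unfold_locales auto
  show "comm_ring_hom (eval2 y1 y2)" "comm_ring_hom (eval3 y1 y2 z)" "comm_ring_hom (eval4 y1 y2 z w)"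
    by (intro comm_ring_hom_poly_map_poly *)+
qed

text \<open>On the way down the prime is contracted one variable at a time, with a condition
  \<open>a3\<close>, ..., \<open>a0\<close> outside it at each level. On the way up each coordinate
  is chosen so that the condition for the next one holds; the last condition is that
  \<open>h\<close> does not vanish.\<close>

theorem nullstellensatz4:
  fixes I :: "'k::alg_closed_field poly poly poly poly set"
  assumes I: "ring_ideal I"
    and h: "\<And>y1 y2 z w. (\<And>f. f \<in> I \<Longrightarrow> eval4 y1 y2 z w f = 0) \<Longrightarrow> eval4 y1 y2 z w h = 0"
  shows "\<exists>n. h ^ n \<in> I"
proof (rule ccontr)
  assume "\<not> ?thesis"
  then obtain Q where Q: "prime_ring_ideal Q" "I \<subseteq> Q" "h \<notin> Q"
    using prime_ring_ideal_avoiding_powers[OF I] by metis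
  obtain a3 where a3: "[:a3:] \<notin> Q" and
    e4: "\<forall>\<phi> :: 'k poly poly poly \<Rightarrow> 'k. comm_ring_hom \<phi> \<and> (\<forall>b. [:b:] \<in> Q \<longrightarrow> \<phi> b = 0) \<and>
      \<phi> a3 \<noteq> 0 \<longrightarrow> (\<exists>c. (\<forall>f\<in>Q. poly (map_poly \<phi> f) c = 0) \<and> poly (map_poly \<phi> h) c \<noteq> 0)"
    using prime_ideal_poly_extend_hom[OF Q(1,3), where 'k = 'k] by blast
  define Q3 where "Q3 = {b. [:b:] \<in> Q}"
  have Q3: "prime_ring_ideal Q3" using prime_ring_ideal_contract[OF Q(1)] by (simp add: Q3_def)
  have a3': "a3 \<notin> Q3" using a3 by (simp add: Q3_def)
  obtain a2 where a2: "[:a2:] \<notin> Q3" and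
    e3: "\<forall>\<phi> :: 'k poly poly \<Rightarrow> 'k. comm_ring_hom \<phi> \<and> (\<forall>b. [:b:] \<in> Q3 \<longrightarrow> \<phi> b = 0) \<and>
      \<phi> a2 \<noteq> 0 \<longrightarrow> (\<exists>c. (\<forall>f\<in>Q3. poly (map_poly \<phi> f) c = 0) \<and> poly (map_poly \<phi> a3) c \<noteq> 0)"
    using prime_ideal_poly_extend_hom[OF Q3 a3', where 'k = 'k] by blast
  define Q2 where "Q2 = {b. [:b:] \<in> Q3}"
  have Q2: "prime_ring_ideal Q2" using prime_ring_ideal_contract[OF Q3] by (simp add: Q2_def)
  have a2': "a2 \<notin> Q2" using a2 by (simp add: Q2_def)
  obtain a1 where a1: "[:a1:] \<notin> Q2" and
    e2: "\<forall>\<phi> :: 'k poly \<Rightarrow> 'k. comm_ring_hom \<phi> \<and> (\<forall>b. [:b:] \<in> Q2 \<longrightarrow> \<phi> b = 0) \<and>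
      \<phi> a1 \<noteq> 0 \<longrightarrow> (\<exists>c. (\<forall>f\<in>Q2. poly (map_poly \<phi> f) c = 0) \<and> poly (map_poly \<phi> a2) c \<noteq> 0)"
    using prime_ideal_poly_extend_hom[OF Q2 a2', where 'k = 'k] by blast
  define Q1 where "Q1 = {b. [:b:] \<in> Q2}"
  have Q1: "prime_ring_ideal Q1" using prime_ring_ideal_contract[OF Q2] by (simp add: Q1_def)
  have a1': "a1 \<notin> Q1" using a1 by (simp add: Q1_def)
  obtain a0 where a0: "[:a0:] \<notin> Q1" and
    e1: "\<forall>\<phi> :: 'k \<Rightarrow> 'k. comm_ring_hom \<phi> \<and> (\<forall>b. [:b:] \<in> Q1 \<longrightarrow> \<phi> b = 0) \<and>
      \<phi> a0 \<noteq> 0 \<longrightarrow> (\<exists>c. (\<forall>f\<in>Q1. poly (map_poly \<phi> f) c = 0) \<and> poly (map_poly \<phi> a1) c \<noteq> 0)"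
    using prime_ideal_poly_extend_hom[OF Q1 a1', where 'k = 'k] by blast
  \<comment> \<open>The contraction to the field is the zero ideal, since nonzero constants are
    units.\<close>
  have Q0: "b = 0" if "[:b:] \<in> Q1" for b
  proof (rule ccontr)
    assume "b \<noteq> 0"
    then have "[:inverse b:] * [:b:] = 1" by simp
    moreover have "[:inverse b:] * [:b:] \<in> Q1"
      by (rule ring_ideal_mult[OF prime_ring_ideal_imp_ideal[OF Q1] that])
    ultimately show False using one_notin_prime_ring_ideal[OF Q1] by simp
  qed
  have "comm_ring_hom (\<lambda>x :: 'k. x)" by unfold_locales auto
  moreover have "a0 \<noteq> 0" using a0 ring_ideal_zero[OF prime_ring_ideal_imp_ideal[OF Q1]] by auto
  ultimately obtain y1 where y1: "\<And>f. f \<in> Q1 \<Longrightarrow> poly f y1 = 0" "poly a1 y1 \<noteq> 0"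
    using e1[rule_format, of "\<lambda>x. x"] Q0 by auto
  obtain y2 where y2: "\<And>f. f \<in> Q2 \<Longrightarrow> eval2 y1 y2 f = 0" "eval2 y1 y2 a2 \<noteq> 0"
    using e2[rule_format, OF conjI[OF comm_ring_hom_eval(1) conjI[OF _ y1(2)]]] y1(1) by (auto simp: Q1_def)
  obtain z where z: "\<And>f. f \<in> Q3 \<Longrightarrow> eval3 y1 y2 z f = 0" "eval3 y1 y2 z a3 \<noteq> 0"
    using e3[rule_format, OF conjI[OF comm_ring_hom_eval(2) conjI[OF _ y2(2)]]] y2(1) by (auto simp: Q2_def)
  obtain w where w: "\<And>f. f \<in> Q \<Longrightarrow> eval4 y1 y2 z w f = 0" "eval4 y1 y2 z w h \<noteq> 0"
    using e4[rule_format, OF conjI[OF comm_ring_hom_eval(3) conjI[OF _ z(2)]]] z(1) by (auto simp: Q3_def)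
  show False using h[of y1 y2 z w] w Q(2) by blast
qed

section \<open>Evaluation of polynomials\<close>

lemma monomial_eval_superset:
  fixes x :: "nat \<Rightarrow> 'a::comm_ring_1"
  assumes "finite S" "Poly_Mapping.keys m \<subseteq> S"
  shows "(\<Prod>i\<in>Poly_Mapping.keys m. x i ^ Poly_Mapping.lookup m i) = (\<Prod>i\<in>S. x i ^ Poly_Mapping.lookup m i)"
  using assms by (intro prod.mono_neutral_left) (auto simp: in_keys_iff)

lemma monomial_eval_add:
  fixes x :: "nat \<Rightarrow> 'a::comm_ring_1"
  shows "(\<Prod>i\<in>Poly_Mapping.keys (m + m'). x i ^ Poly_Mapping.lookup (m + m') i) =
    (\<Prod>i\<in>Poly_Mapping.keys m. x i ^ Poly_Mapping.lookup m i) *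
    (\<Prod>i\<in>Poly_Mapping.keys m'. x i ^ Poly_Mapping.lookup m' i)"
proof -
  let ?S = "Poly_Mapping.keys m \<union> Poly_Mapping.keys m'"
  have S: "finite ?S" "Poly_Mapping.keys (m + m') \<subseteq> ?S" using keys_add[of m m'] by auto
  show ?thesis
    using monomial_eval_superset[OF S] monomial_eval_superset[OF S(1), of m x] monomial_eval_superset[OF S(1), of m' x]
    by (simp add: lookup_add power_add prod.distrib)
qed

lemma eval_mpoly_superset:
  assumes "finite S" "Poly_Mapping.keys f \<subseteq> S"
  shows "eval_mpoly x f = (\<Sum>m\<in>S. Poly_Mapping.lookup f m *
        (\<Prod>i \<in> Poly_Mapping.keys m. x i ^ Poly_Mapping.lookup m i))"
  unfolding eval_mpoly_def using assms by (intro sum.mono_neutral_left) (auto simp: in_keys_iff)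

lemma eval_mpoly_single:
  "eval_mpoly x (Poly_Mapping.single m c) = c * (\<Prod>i \<in> Poly_Mapping.keys m. x i ^ Poly_Mapping.lookup m i)"
  by (subst eval_mpoly_superset[of "{m}"]) auto

lemma eval_mpoly_add: "eval_mpoly x (f + g) = eval_mpoly x f + eval_mpoly x g"
proof -
  let ?S = "Poly_Mapping.keys f \<union> Poly_Mapping.keys g"
  have S: "finite ?S" "Poly_Mapping.keys (f + g) \<subseteq> ?S" using keys_add[of f g] by auto
  show ?thesis
    using eval_mpoly_superset[OF S] eval_mpoly_superset[OF S(1), of f x] eval_mpoly_superset[OF S(1), of g x]
    by (simp add: lookup_add distrib_right sum.distrib)
qed

lemma eval_mpoly_zero: "eval_mpoly x 0 = 0"
  by (simp add: eval_mpoly_def)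

lemma eval_mpoly_sum: "eval_mpoly x (\<Sum>a\<in>A. f a) = (\<Sum>a\<in>A. eval_mpoly x (f a))"
  by (induction A rule: infinite_finite_induct) (auto simp: eval_mpoly_zero eval_mpoly_add)

lemma mpoly_sum_singles: "f = (\<Sum>m\<in>Poly_Mapping.keys f. Poly_Mapping.single m (Poly_Mapping.lookup f m))"
  by (rule poly_mapping_eqI)
     (auto simp: lookup_sum lookup_single when_def in_keys_iff sum.delta)

lemma eval_mpoly_mult:
  fixes f g :: "'a::comm_ring_1 mpoly"
  shows "eval_mpoly x (f * g) = eval_mpoly x f * eval_mpoly x g"
proof -
  have "eval_mpoly x (Poly_Mapping.single m c * Poly_Mapping.single m' c') =
      eval_mpoly x (Poly_Mapping.single m c) * eval_mpoly x (Poly_Mapping.single m' c')" for m c m' c'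
    by (simp add: mult_single eval_mpoly_single monomial_eval_add mult_ac)
  then have "eval_mpoly x ((\<Sum>m\<in>A. Poly_Mapping.single m (u m)) * (\<Sum>m\<in>B. Poly_Mapping.single m (v m))) =
      eval_mpoly x (\<Sum>m\<in>A. Poly_Mapping.single m (u m)) * eval_mpoly x (\<Sum>m\<in>B. Poly_Mapping.single m (v m))"
    for A B and u v :: "(nat \<Rightarrow>\<^sub>0 nat) \<Rightarrow> 'a"
    by (simp add: sum_product eval_mpoly_sum)
  from this[of "Poly_Mapping.lookup f" "Poly_Mapping.keys f" "Poly_Mapping.lookup g" "Poly_Mapping.keys g"]
  show ?thesis by (simp flip: mpoly_sum_singles)
qed

lemma comm_ring_hom_eval_mpoly: "comm_ring_hom (eval_mpoly x)"
proof
  show "eval_mpoly x 1 = 1"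
    using eval_mpoly_single[of x 0 1] by simp
qed (simp_all add: eval_mpoly_add eval_mpoly_mult eval_mpoly_zero)

interpretation eval_mpoly: comm_ring_hom "eval_mpoly x" for x :: "nat \<Rightarrow> 'a::comm_ring_1"
  by (rule comm_ring_hom_eval_mpoly)

section \<open>Exponent bounds and substitution\<close>

definition mpoly_const :: "'k::comm_ring_1 \<Rightarrow> 'k mpoly" where
  "mpoly_const c = Poly_Mapping.single 0 c"

definition mpoly_var :: "nat \<Rightarrow> 'k::comm_ring_1 mpoly" where
  "mpoly_var i = Poly_Mapping.single (Poly_Mapping.single i 1) 1"

lemma eval_mpoly_const [simp]: "eval_mpoly x (mpoly_const c) = c"
  by (simp add: mpoly_const_def eval_mpoly_single)

lemma eval_mpoly_var [simp]: "eval_mpoly x (mpoly_var i) = x i"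
  by (simp add: mpoly_var_def eval_mpoly_single)

text \<open>With each exponent bounded separately, the admissible monomials form a box of
  \<open>(L + 1) ^ N\<close> points, which is easy to count, and the bounds still add under
  multiplication.\<close>

definition bounded_mpolys :: "nat \<Rightarrow> nat \<Rightarrow> 'k::comm_ring_1 mpoly set" where
  "bounded_mpolys N L = {f \<in> mpoly_ring N. \<forall>m\<in>Poly_Mapping.keys f. \<forall>i. Poly_Mapping.lookup m i \<le> L}"

lemma bounded_mpolys_zero: "0 \<in> bounded_mpolys N L"
  by (simp add: bounded_mpolys_def mpoly_ring_def)

lemma bounded_mpolys_const: "mpoly_const c \<in> bounded_mpolys N L"
  by (auto simp: bounded_mpolys_def mpoly_ring_def mpoly_const_def)

lemma bounded_mpolys_var: "i \<in> {1..N} \<Longrightarrow> L \<ge> 1 \<Longrightarrow> mpoly_var i \<in> bounded_mpolys N L"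
  by (auto simp: bounded_mpolys_def mpoly_ring_def mpoly_var_def lookup_single when_def)

lemma bounded_mpolys_mult:
  assumes "f \<in> bounded_mpolys N L" "g \<in> bounded_mpolys N L'"
  shows "f * g \<in> bounded_mpolys N (L + L')"
proof -
  have "Poly_Mapping.keys m \<subseteq> {1..N} \<and> (\<forall>i. Poly_Mapping.lookup m i \<le> L + L')"
    if "m \<in> Poly_Mapping.keys (f * g)" for m
  proof -
    obtain k l where kl: "m = k + l" "k \<in> Poly_Mapping.keys f" "l \<in> Poly_Mapping.keys g"
      using \<open>m \<in> _\<close> keys_mult[of f g] by blast
    then have "Poly_Mapping.keys k \<subseteq> {1..N}" "Poly_Mapping.keys l \<subseteq> {1..N}"
      "Poly_Mapping.lookup k i \<le> L" "Poly_Mapping.lookup l i \<le> L'" for i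
      using assms by (auto simp: bounded_mpolys_def mpoly_ring_def)
    then show ?thesis using keys_add[of k l] by (auto simp: kl(1) lookup_add add_mono)
  qed
  then show ?thesis by (auto simp: bounded_mpolys_def mpoly_ring_def)
qed

lemma bounded_mpolys_power:
  "f \<in> bounded_mpolys N L \<Longrightarrow> f ^ k \<in> bounded_mpolys N (k * L)"
proof (induction k)
  case 0
  then show ?case using bounded_mpolys_const[of 1 N 0] by (simp add: mpoly_const_def)
next
  case (Suc k)
  then show ?case using bounded_mpolys_mult[of f N L "f ^ k" "k * L"] by simp
qed

lemma bounded_mpolys_mono: "L \<le> L' \<Longrightarrow> bounded_mpolys N L \<subseteq> bounded_mpolys N L'"
  unfolding bounded_mpolys_def by (auto dest: order_trans)

lemma mpoly_ring_bounded:
  assumes "f \<in> mpoly_ring N"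
  shows "\<exists>L. f \<in> bounded_mpolys N L"
proof -
  \<comment> \<open>The 0 accounts for variables that do not occur in a monomial.\<close>
  let ?S = "insert 0 ((\<lambda>(m, i). Poly_Mapping.lookup m i) ` (SIGMA m:Poly_Mapping.keys f. Poly_Mapping.keys m))"
  have fin: "finite ?S" by auto
  have "Poly_Mapping.lookup m i \<le> Max ?S" if "m \<in> Poly_Mapping.keys f" for m i
  proof (rule Max_ge[OF fin])
    show "Poly_Mapping.lookup m i \<in> ?S"
      using that by (cases "i \<in> Poly_Mapping.keys m") (force simp: image_iff, simp add: in_keys_iff)
  qed
  then show ?thesis using assms by (auto simp: bounded_mpolys_def)
qed

lemma bounded_mpolys_subset: "bounded_mpolys N L \<subseteq> mpoly_ring N"
  by (auto simp: bounded_mpolys_def)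

lemma mpoly_ring_zero: "0 \<in> mpoly_ring N"
  and mpoly_ring_const: "mpoly_const c \<in> mpoly_ring N"
  and mpoly_ring_var: "i \<in> {1..N} \<Longrightarrow> mpoly_var i \<in> mpoly_ring N"
  using bounded_mpolys_zero[of N 1] bounded_mpolys_const[of c N 1] bounded_mpolys_var[of i N 1]
    bounded_mpolys_subset[of N 1] by auto

lemma mpoly_ring_one: "1 \<in> mpoly_ring N"
  using mpoly_ring_const[of 1 N] by (simp add: mpoly_const_def)

lemma mpoly_ring_add: "f \<in> mpoly_ring N \<Longrightarrow> g \<in> mpoly_ring N \<Longrightarrow> f + g \<in> mpoly_ring N"
  using keys_add[of f g] unfolding mpoly_ring_def by blast

lemma mpoly_ring_mult:
  assumes "f \<in> mpoly_ring N" "g \<in> mpoly_ring N"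
  shows "f * g \<in> mpoly_ring N"
proof -
  obtain L L' where "f \<in> bounded_mpolys N L" "g \<in> bounded_mpolys N L'"
    using mpoly_ring_bounded assms by metis
  then show ?thesis using bounded_mpolys_mult bounded_mpolys_subset by blast
qed

lemma mpoly_ring_diff: "f \<in> mpoly_ring N \<Longrightarrow> g \<in> mpoly_ring N \<Longrightarrow> f - g \<in> mpoly_ring N"
  using mpoly_ring_add[of f N "mpoly_const (- 1) * g"] mpoly_ring_mult[OF mpoly_ring_const, of g N "- 1"]
  by (simp add: mpoly_const_def single_uminus)

lemma mpoly_ring_power: "f \<in> mpoly_ring N \<Longrightarrow> f ^ k \<in> mpoly_ring N"
  by (induction k) (auto simp: mpoly_ring_one mpoly_ring_mult)

lemma mpoly_ring_sum: "(\<And>a. a \<in> A \<Longrightarrow> f a \<in> mpoly_ring N) \<Longrightarrow> (\<Sum>a\<in>A. f a) \<in> mpoly_ring N"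
  by (induction A rule: infinite_finite_induct) (auto simp: mpoly_ring_zero mpoly_ring_add)

lemma mpoly_ring_prod: "(\<And>a. a \<in> A \<Longrightarrow> f a \<in> mpoly_ring N) \<Longrightarrow> (\<Prod>a\<in>A. f a) \<in> mpoly_ring N"
  by (induction A rule: infinite_finite_induct) (auto simp: mpoly_ring_one mpoly_ring_mult)

lemmas mpoly_ring_intros = mpoly_ring_zero mpoly_ring_one mpoly_ring_const mpoly_ring_var mpoly_ring_add
  mpoly_ring_mult mpoly_ring_diff mpoly_ring_power mpoly_ring_sum mpoly_ring_prod

lemma mpoly_ringD:
  "f \<in> mpoly_ring N \<Longrightarrow> m \<in> Poly_Mapping.keys f \<Longrightarrow> i \<in> Poly_Mapping.keys m \<Longrightarrow> i \<in> {1..N}"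
  unfolding mpoly_ring_def by blast

text \<open>The target is an arbitrary ring because the same substitution serves for polynomial
  curves, for iterated polynomial rings in two and four variables, and for multivariate
  polynomials.\<close>

definition subst_mpoly :: "('k \<Rightarrow> 'a) \<Rightarrow> (nat \<Rightarrow> 'a) \<Rightarrow> 'k::comm_ring_1 mpoly \<Rightarrow> 'a::comm_ring_1" where
  "subst_mpoly \<iota> X f =
     (\<Sum>m \<in> Poly_Mapping.keys f. \<iota> (Poly_Mapping.lookup f m) *
        (\<Prod>i \<in> Poly_Mapping.keys m. X i ^ Poly_Mapping.lookup m i))"

lemma hom_subst_mpoly:
  assumes "comm_ring_hom \<phi>" "\<And>c. \<phi> (\<iota> c) = c" "f \<in> mpoly_ring N" "\<And>i. i \<in> {1..N} \<Longrightarrow> \<phi> (X i) = x i"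
  shows "\<phi> (subst_mpoly \<iota> X f) = eval_mpoly x f"
proof -
  interpret comm_ring_hom \<phi> by fact
  have "\<phi> (\<Prod>i \<in> Poly_Mapping.keys m. X i ^ Poly_Mapping.lookup m i) =
      (\<Prod>i \<in> Poly_Mapping.keys m. x i ^ Poly_Mapping.lookup m i)" if "m \<in> Poly_Mapping.keys f" for m
    unfolding hom_prod hom_power
    by (intro prod.cong) (use mpoly_ringD[OF assms(3) that] assms(4) in auto)
  then show ?thesis
    unfolding subst_mpoly_def eval_mpoly_def hom_sum
    by (intro sum.cong) (auto simp: hom_mult assms(2))
qed

lemma subst_mpoly_in_ring:
  assumes "f \<in> mpoly_ring N" "\<And>i. i \<in> {1..N} \<Longrightarrow> X i \<in> mpoly_ring M"
  shows "subst_mpoly mpoly_const X f \<in> mpoly_ring M"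
  unfolding subst_mpoly_def
  by (intro mpoly_ring_sum mpoly_ring_mult mpoly_ring_prod mpoly_ring_power mpoly_ring_const assms(2))
     (rule mpoly_ringD[OF assms(1)])

section \<open>Dimension\<close>

lemma algebraic_set_subset: "algebraic_set N Z \<Longrightarrow> Z \<subseteq> affine_space N"
  by (auto simp: algebraic_set_def zero_set_def)

lemma algebraic_set_zero_set: "F \<subseteq> mpoly_ring N \<Longrightarrow> algebraic_set N (zero_set N F)"
  by (auto simp: algebraic_set_def)

lemma algebraic_set_Int:
  assumes "algebraic_set N A" "algebraic_set N B"
  shows "algebraic_set N (A \<inter> B)"
proof -
  obtain F G where "F \<subseteq> mpoly_ring N" "G \<subseteq> mpoly_ring N" "A = zero_set N F" "B = zero_set N G"
    using assms by (auto simp: algebraic_set_def)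
  then have "F \<union> G \<subseteq> mpoly_ring N" "A \<inter> B = zero_set N (F \<union> G)"
    by (auto simp: zero_set_def)
  then show ?thesis using algebraic_set_zero_set by metis
qed

lemma irreducible_algebraic_set_mult:
  assumes Z: "irreducible_algebraic_set N Z" and f: "f \<in> mpoly_ring N" and g: "g \<in> mpoly_ring N"
    and 0: "\<And>x. x \<in> Z \<Longrightarrow> eval_mpoly x f * eval_mpoly x g = 0"
  shows "(\<forall>x\<in>Z. eval_mpoly x f = 0) \<or> (\<forall>x\<in>Z. eval_mpoly x g = 0)"
proof -
  have aZ: "algebraic_set N Z" using Z by (simp add: irreducible_algebraic_set_def)
  have "Z = (Z \<inter> zero_set N {f}) \<union> (Z \<inter> zero_set N {g})"
    using 0 algebraic_set_subset[OF aZ] by (auto simp: zero_set_def)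
  moreover have "algebraic_set N (Z \<inter> zero_set N {f})" "algebraic_set N (Z \<inter> zero_set N {g})"
    using aZ f g by (auto intro: algebraic_set_Int algebraic_set_zero_set)
  ultimately have "Z = Z \<inter> zero_set N {f} \<or> Z = Z \<inter> zero_set N {g}"
    using Z unfolding irreducible_algebraic_set_def by blast
  then show ?thesis by (auto simp: zero_set_def)
qed

text \<open>If \<open>Z\<close> were a proper union, some \<open>f\<close> would vanish on one part
  but not at \<open>x\<close>, some \<open>g\<close> on the other part but not at \<open>y\<close>.
  Along a polynomial curve in \<open>Z\<close> from \<open>x\<close> to \<open>y\<close> both become
  nonzero univariate polynomials, yet their product vanishes everywhere on an infinite
  field.\<close>

lemma irreducible_algebraic_setI:
  fixes Z :: "(nat \<Rightarrow> 'k::alg_closed_field) set"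
  assumes Z: "algebraic_set N Z" "Z \<noteq> {}"
    and curve: "\<And>x y. x \<in> Z \<Longrightarrow> y \<in> Z \<Longrightarrow> \<exists>X. (\<forall>i\<in>{1..N}. poly (X i) 0 = x i \<and> poly (X i) 1 = y i) \<and>
      (\<forall>t. (\<lambda>i\<in>{1..N}. poly (X i) t) \<in> Z)"
  shows "irreducible_algebraic_set N Z"
  unfolding irreducible_algebraic_set_def
proof (intro conjI allI impI Z)
  fix A B assume A: "algebraic_set N A" and B: "algebraic_set N B" and AB: "Z = A \<union> B"
  have sep: "\<exists>x f. x \<in> Z \<and> f \<in> mpoly_ring N \<and> eval_mpoly x f \<noteq> 0 \<and> (\<forall>y\<in>A. eval_mpoly y f = 0)"
    if closed: "algebraic_set N A" and sub: "Z \<noteq> A" "A \<subseteq> Z" for A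
  proof -
    obtain F where F: "F \<subseteq> mpoly_ring N" "A = zero_set N F" using closed by (auto simp: algebraic_set_def)
    obtain x where x: "x \<in> Z" "x \<notin> A" using sub by auto
    then obtain f where "f \<in> F" "eval_mpoly x f \<noteq> 0"
      using F algebraic_set_subset[OF Z(1)] by (auto simp: zero_set_def)
    then show ?thesis using x F by (auto simp: zero_set_def intro!: exI[of _ x] exI[of _ f])
  qed
  show "Z = A \<or> Z = B"
  proof (rule ccontr)
    assume "\<not> ?thesis"
    then obtain x f y g where x: "x \<in> Z" and y: "y \<in> Z" and f: "f \<in> mpoly_ring N" and g: "g \<in> mpoly_ring N"
      and fx: "eval_mpoly x f \<noteq> 0" and gy: "eval_mpoly y g \<noteq> 0"
      and fA: "\<And>y. y \<in> A \<Longrightarrow> eval_mpoly y f = 0" and gB: "\<And>y. y \<in> B \<Longrightarrow> eval_mpoly y g = 0"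
      using sep[OF A] sep[OF B] AB by (metis Un_upper1 Un_upper2)
    obtain X where X0: "\<forall>i\<in>{1..N}. poly (X i) 0 = x i \<and> poly (X i) 1 = y i"
      and XZ: "\<And>t. (\<lambda>i\<in>{1..N}. poly (X i) t) \<in> Z" using curve[OF x y] by blast
    have sub: "poly (subst_mpoly (\<lambda>c. [:c:]) X h) t = eval_mpoly z h"
      if "h \<in> mpoly_ring N" "\<And>i. i \<in> {1..N} \<Longrightarrow> poly (X i) t = z i" for h t z
      by (rule hom_subst_mpoly[OF comm_ring_hom_eval(1) _ that]) simp
    let ?p = "subst_mpoly (\<lambda>c. [:c:]) X f" and ?q = "subst_mpoly (\<lambda>c. [:c:]) X g"
    have "poly ?p 0 \<noteq> 0" "poly ?q 1 \<noteq> 0"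
      using sub[OF f, of 0 x] sub[OF g, of 1 y] X0 fx gy by auto
    then have "?p \<noteq> 0" "?q \<noteq> 0" by auto
    moreover have "?p * ?q = 0"
    proof (rule poly_eq_0_if_cofinitely[of "{}"])
      fix t
      let ?z = "\<lambda>i\<in>{1..N}. poly (X i) t"
      have "eval_mpoly ?z f * eval_mpoly ?z g = 0" using XZ[of t] AB fA gB by fastforce
      then show "poly (?p * ?q) t = 0" using sub[OF f, of t ?z] sub[OF g, of t ?z] by simp
    qed simp
    ultimately show False by simp
  qed
qed

section \<open>Independence along a chain, dependence by counting\<close>

lemma sum_lessThan_mult:
  fixes h :: "nat \<Rightarrow> 'a::comm_monoid_add"
  shows "(\<Sum>e<A * B. h e) = (\<Sum>i<A. \<Sum>j<B. h (j + i * B))"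
proof -
  have "sum h {i * B..<i * B + B} = (\<Sum>j<B. h (j + i * B))" for i
    using sum.shift_bounds_nat_ivl[of h 0 "i * B" B] by (simp add: add.commute atLeast0LessThan)
  then show ?thesis using sum.nat_group[of h B A] by simp
qed

text \<open>A monomial in \<open>f 0, \<dots>, f (k - 1)\<close> with exponents less than \<open>B\<close> is encoded
  by the number whose digits to the base \<open>B\<close> are the exponents.\<close>

lemma chain_algebraically_independent:
  fixes Z :: "nat \<Rightarrow> (nat \<Rightarrow> 'k::field) set"
  assumes "\<And>i. i \<le> k \<Longrightarrow> irreducible_algebraic_set N (Z i)"
    and "\<And>i. i < k \<Longrightarrow> Z i \<subseteq> Z (Suc i)"
    and "\<And>i. i < k \<Longrightarrow> f i \<in> mpoly_ring N"
    and "\<And>i x. i < k \<Longrightarrow> x \<in> Z i \<Longrightarrow> eval_mpoly x (f i) = 0"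
    and "\<And>i. i < k \<Longrightarrow> \<exists>x\<in>Z (Suc i). eval_mpoly x (f i) \<noteq> 0"
    and "\<And>x. x \<in> Z k \<Longrightarrow> (\<Sum>e<B ^ k. c e * (\<Prod>i<k. eval_mpoly x (f i) ^ (e div B ^ i mod B))) = 0"
    and "e < B ^ k" and B: "B > 0"
  shows "c e = 0"
  using assms(1-7)
proof (induction k arbitrary: c e)
  case 0
  \<comment> \<open>Only the constant \<open>c 0\<close> is left; a point at which to evaluate it
    exists because irreducible sets are nonempty.\<close>
  then obtain x where "x \<in> Z 0" by (force simp: irreducible_algebraic_set_def)
  then show ?case using "0.prems"(6)[of x] "0.prems"(7) by simp
next
  case (Suc k)
  have digit: "(e + j * B ^ k) div B ^ i mod B = e div B ^ i mod B" if "i < k" for e j i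
  proof -
    have "B ^ k = B ^ (k - i - 1) * B * B ^ i"
      using that by (simp flip: power_add power_Suc2 add: Suc_diff_Suc)
    then have eq: "e + j * B ^ k = e + (j * B ^ (k - i - 1) * B) * B ^ i" by (simp only: mult_ac)
    have "(e + j * B ^ k) div B ^ i = j * B ^ (k - i - 1) * B + e div B ^ i"
      unfolding eq by (rule div_mult_self1) (use B in simp)
    then show ?thesis by simp
  qed
  \<comment> \<open>The coefficient of \<open>f k ^ j\<close> when the relation is sorted by the
    leading digit \<open>j\<close>.\<close>
  define q where "q j = (\<Sum>e<B ^ k. mpoly_const (c (e + j * B ^ k)) * (\<Prod>i<k. f i ^ (e div B ^ i mod B)))" for j
  have q: "q j \<in> mpoly_ring N" for j
    unfolding q_def using Suc.prems(3) by (intro mpoly_ring_intros) auto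
  have eval_q: "eval_mpoly x (q j) = (\<Sum>e<B ^ k. c (e + j * B ^ k) * (\<Prod>i<k. eval_mpoly x (f i) ^ (e div B ^ i mod B)))"
    for x j by (simp add: q_def eval_mpoly.hom_sum eval_mpoly.hom_mult eval_mpoly.hom_prod eval_mpoly.hom_power)
  have rel: "(\<Sum>j<B. eval_mpoly x (f k) ^ j * eval_mpoly x (q j)) = 0" if x: "x \<in> Z (Suc k)" for x
  proof -
    have "(\<Sum>e<B ^ Suc k. c e * (\<Prod>i<Suc k. eval_mpoly x (f i) ^ (e div B ^ i mod B))) =
      (\<Sum>j<B. \<Sum>e<B ^ k. c (e + j * B ^ k) *
        (\<Prod>i<Suc k. eval_mpoly x (f i) ^ ((e + j * B ^ k) div B ^ i mod B)))"
      by (simp only: power_Suc sum_lessThan_mult)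
    also have "\<dots> = (\<Sum>j<B. eval_mpoly x (f k) ^ j * eval_mpoly x (q j))"
      unfolding eval_q sum_distrib_left using B
      by (intro sum.cong refl) (simp add: digit mult_ac)
    finally show ?thesis using Suc.prems(6)[OF x] by simp
  qed
  show ?case
  proof (rule ccontr)
    assume "c e \<noteq> 0"
    then have "c (e mod B ^ k + e div B ^ k * B ^ k) \<noteq> 0" by (simp add: mod_div_mult_eq)
    moreover have "e div B ^ k < B" using Suc.prems(7) by (simp add: less_mult_imp_div_less)
    moreover have "e mod B ^ k < B ^ k" using B by simp
    ultimately have ex: "\<exists>j. j < B \<and> (\<exists>e<B ^ k. c (e + j * B ^ k) \<noteq> 0)" by blast
    \<comment> \<open>The lowest power of \<open>f k\<close> with a nonzero coefficient. It can be
      cancelled on the irreducible set \<open>Z (Suc k)\<close>, where \<open>f k\<close> does not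
      vanish identically. On \<open>Z k\<close> the remaining powers of \<open>f k\<close> vanish,
      which leaves a relation among the earlier functions.\<close>
    define j0 where "j0 = (LEAST j. j < B \<and> (\<exists>e<B ^ k. c (e + j * B ^ k) \<noteq> 0))"
    have j0: "j0 < B" "\<exists>e<B ^ k. c (e + j0 * B ^ k) \<noteq> 0"
      using LeastI_ex[OF ex] by (auto simp: j0_def)
    have less: "c (e + j * B ^ k) = 0" if "j < j0" "e < B ^ k" for j e
      using not_less_Least[of j "\<lambda>j. j < B \<and> (\<exists>e<B ^ k. c (e + j * B ^ k) \<noteq> 0)"] that j0(1)
      by (auto simp: j0_def)
    define G where "G = (\<Sum>j\<in>{j0..<B}. f k ^ (j - j0) * q j)"
    have G: "G \<in> mpoly_ring N"
      unfolding G_def using Suc.prems(3) q by (intro mpoly_ring_intros) auto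
    have eval_G: "eval_mpoly x G = (\<Sum>j\<in>{j0..<B}. eval_mpoly x (f k) ^ (j - j0) * eval_mpoly x (q j))" for x
      by (simp add: G_def eval_mpoly.hom_sum eval_mpoly.hom_mult eval_mpoly.hom_power)
    have "eval_mpoly x (f k ^ j0) * eval_mpoly x G = 0" if x: "x \<in> Z (Suc k)" for x
    proof -
      have "eval_mpoly x (f k ^ j0) * eval_mpoly x G =
          (\<Sum>j\<in>{j0..<B}. eval_mpoly x (f k) ^ j * eval_mpoly x (q j))"
        unfolding eval_G sum_distrib_left eval_mpoly.hom_power mult.assoc[symmetric]
        by (intro sum.cong) (auto simp flip: power_add)
      also have "\<dots> = (\<Sum>j<B. eval_mpoly x (f k) ^ j * eval_mpoly x (q j))"
        by (intro sum.mono_neutral_left) (auto simp: eval_q less)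
      finally show ?thesis using rel[OF x] by simp
    qed
    then have "(\<forall>x\<in>Z (Suc k). eval_mpoly x (f k ^ j0) = 0) \<or> (\<forall>x\<in>Z (Suc k). eval_mpoly x G = 0)"
      using Suc.prems(1,3) G by (intro irreducible_algebraic_set_mult[of N]) (auto intro: mpoly_ring_power)
    then have G0: "eval_mpoly x G = 0" if "x \<in> Z (Suc k)" for x
      using Suc.prems(5)[of k] that by (auto simp: eval_mpoly.hom_power)
    have "eval_mpoly x (q j0) = 0" if x: "x \<in> Z k" for x
    proof -
      have "eval_mpoly x (q j0) = (\<Sum>j\<in>{j0}. eval_mpoly x (f k) ^ (j - j0) * eval_mpoly x (q j))" by simp
      also have "\<dots> = eval_mpoly x G"
        unfolding eval_G using j0(1) Suc.prems(4)[of k x] x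
        by (intro sum.mono_neutral_left) (auto simp: zero_power_eq)
      finally show ?thesis using G0 Suc.prems(2)[of k] x by auto
    qed
    then have "c (e + j0 * B ^ k) = 0" if "e < B ^ k" for e
      using Suc.prems(1-5) that by (intro Suc.IH[of "\<lambda>e. c (e + j0 * B ^ k)"]) (auto simp: eval_q)
    then show False using j0(2) by auto
  qed
qed

lemma homogeneous_system_nontrivial_solution:
  fixes M :: "'a \<Rightarrow> 'b \<Rightarrow> 'k::field"
  assumes "finite T" "finite S" "card T < card S"
  shows "\<exists>c. (\<exists>s\<in>S. c s \<noteq> 0) \<and> (\<forall>t\<in>T. (\<Sum>s\<in>S. c s * M s t) = 0)"
  using assms
proof (induction T arbitrary: S M rule: finite_induct)
  case empty
  then have "S \<noteq> {}" by auto
  then show ?case by (intro exI[of _ "\<lambda>_. 1"]) auto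
next
  case (insert t T)
  show ?case
  proof (cases "\<exists>s\<in>S. M s t \<noteq> 0")
    case False
    obtain c where "\<exists>s\<in>S. c s \<noteq> 0" "\<forall>t\<in>T. (\<Sum>s\<in>S. c s * M s t) = 0"
      using insert.IH[OF insert.prems(1), of M] insert.prems(2) insert.hyps by auto
    then show ?thesis using False by (intro exI[of _ c]) auto
  next
    case True
    then obtain s0 where s0: "s0 \<in> S" "M s0 t \<noteq> 0" by blast
    \<comment> \<open>Equation \<open>t\<close> eliminates the unknown \<open>s0\<close>; the value
      of \<open>c'\<close> at \<open>s0\<close> is the one that equation \<open>t\<close>
      prescribes.\<close>
    let ?M = "\<lambda>s t'. M s t' - M s t / M s0 t * M s0 t'"
    have "card T < card (S - {s0})" using insert s0 by simp
    then obtain c where c: "\<exists>s\<in>S - {s0}. c s \<noteq> 0" "\<And>t'. t' \<in> T \<Longrightarrow> (\<Sum>s\<in>S - {s0}. c s * ?M s t') = 0"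
      using insert.IH[of "S - {s0}" ?M] insert.prems(1) by blast
    define c' where "c' = c(s0 := - (\<Sum>s\<in>S - {s0}. c s * (M s t / M s0 t)))"
    have sum: "(\<Sum>s\<in>S. c' s * M s t') = (\<Sum>s\<in>S - {s0}. c s * ?M s t')" for t'
    proof -
      have "(\<Sum>s\<in>S. c' s * M s t') = c' s0 * M s0 t' + (\<Sum>s\<in>S - {s0}. c' s * M s t')"
        using s0(1) insert.prems(1) by (simp add: sum.remove)
      also have "(\<Sum>s\<in>S - {s0}. c' s * M s t') = (\<Sum>s\<in>S - {s0}. c s * M s t')"
        by (intro sum.cong) (auto simp: c'_def)
      also have "c' s0 * M s0 t' = - (\<Sum>s\<in>S - {s0}. c s * (M s t / M s0 t * M s0 t'))"
        by (simp add: c'_def sum_distrib_right mult.assoc)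
      finally show ?thesis by (simp add: right_diff_distrib sum_subtractf)
    qed
    have "(\<Sum>s\<in>S. c' s * M s t') = 0" if "t' \<in> insert t T" for t'
      using that c(2) s0(2) unfolding sum by auto
    moreover have "\<exists>s\<in>S. c' s \<noteq> 0" using c(1) by (auto simp: c'_def)
    ultimately show ?thesis by blast
  qed
qed

lemma card_bounded_monomials:
  "finite {m. Poly_Mapping.keys m \<subseteq> {1..n} \<and> (\<forall>i. Poly_Mapping.lookup m i \<le> L)}" (is "finite ?S")
  "card {m. Poly_Mapping.keys m \<subseteq> {1..n} \<and> (\<forall>i. Poly_Mapping.lookup m i \<le> L)} \<le> (L + 1) ^ n"
proof -
  let ?r = "\<lambda>m :: nat \<Rightarrow>\<^sub>0 nat. restrict (Poly_Mapping.lookup m) {1..n}"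
  let ?T = "{1..n} \<rightarrow>\<^sub>E {..L}"
  have inj: "inj_on ?r ?S"
  proof (rule inj_onI)
    fix m m' assume m: "m \<in> ?S" "m' \<in> ?S" "?r m = ?r m'"
    show "m = m'"
    proof (rule poly_mapping_eqI)
      fix i show "Poly_Mapping.lookup m i = Poly_Mapping.lookup m' i"
      proof (cases "i \<in> {1..n}")
        case True
        then show ?thesis using fun_cong[OF m(3), of i] by simp
      next
        case False
        then have "i \<notin> Poly_Mapping.keys m" "i \<notin> Poly_Mapping.keys m'" using m(1,2) by blast+
        then show ?thesis by (simp add: in_keys_iff)
      qed
    qed
  qed
  have sub: "?r ` ?S \<subseteq> ?T" by auto
  have fin: "finite ?T" by (intro finite_PiE) auto
  show "finite ?S" using inj sub fin by (rule inj_on_finite)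
  have "card ?S \<le> card ?T" using inj sub fin by (rule card_inj_on_le)
  also have "\<dots> = (L + 1) ^ n" by (simp add: card_PiE)
  finally show "card ?S \<le> (L + 1) ^ n" .
qed

text \<open>There are \<open>B ^ k\<close> products of the \<open>g i\<close> with exponents below
  \<open>B\<close>, while the number of monomials that can occur in them grows only like
  \<open>B ^ n\<close>. For large \<open>B\<close> linear algebra yields a relation.\<close>

lemma mpolys_algebraically_dependent:
  fixes g :: "nat \<Rightarrow> 'k::field mpoly"
  assumes g: "\<And>i. i < k \<Longrightarrow> g i \<in> mpoly_ring n" and nk: "n < k"
  obtains B c e where "B > 0" "e < B ^ k" "c e \<noteq> 0"
    "(\<Sum>e<B ^ k. mpoly_const (c e) * (\<Prod>i<k. g i ^ (e div B ^ i mod B))) = 0"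
proof -
  have "\<forall>i. \<exists>L. i < k \<longrightarrow> g i \<in> bounded_mpolys n L" using g mpoly_ring_bounded by blast
  then obtain Li where Li: "\<And>i. i < k \<Longrightarrow> g i \<in> bounded_mpolys n (Li i)" by metis
  define L where "L = (\<Sum>i<k. Li i)"
  have "Li i \<le> L" if "i < k" for i
    unfolding L_def using that by (intro member_le_sum) auto
  then have L: "g i \<in> bounded_mpolys n L" if "i < k" for i
    using Li[OF that] bounded_mpolys_mono that by blast
  \<comment> \<open>Large enough for \<open>(k * (B * L) + 1) ^ n \<le> (k * L + 1) ^ n * B ^ n < B
    ^ Suc n \<le> B ^ k\<close>.\<close>
  define B where "B = Suc ((k * L + 1) ^ n)"
  define S where "S = {m. Poly_Mapping.keys m \<subseteq> {1..n} \<and> (\<forall>i. Poly_Mapping.lookup m i \<le> k * (B * L))}"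
  define G where "G e = (\<Prod>i<k. g i ^ (e div B ^ i mod B))" for e
  have B0: "B > 0" by (simp add: B_def)
  have prod: "(\<Prod>i<k'. g i ^ (e div B ^ i mod B)) \<in> bounded_mpolys n (k' * (B * L))" if "k' \<le> k" for e k'
    using that
  proof (induction k')
    case 0
    then show ?case using bounded_mpolys_const[of 1 n 0] by (simp add: mpoly_const_def)
  next
    case (Suc k')
    have le: "e div B ^ k' mod B * L \<le> B * L" using B0 by (intro mult_right_mono) auto
    have "g k' ^ (e div B ^ k' mod B) \<in> bounded_mpolys n (e div B ^ k' mod B * L)"
      using Suc.prems by (intro bounded_mpolys_power L) simp
    then have "g k' ^ (e div B ^ k' mod B) \<in> bounded_mpolys n (B * L)"
      using bounded_mpolys_mono[OF le] by blast
    then show ?case using bounded_mpolys_mult[OF Suc.IH] Suc.prems by (simp add: add.commute)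
  qed
  have G: "Poly_Mapping.keys (G e) \<subseteq> S" for e
    using prod[of k e] by (auto simp: G_def S_def bounded_mpolys_def mpoly_ring_def)
  have "card S \<le> (k * (B * L) + 1) ^ n"
    unfolding S_def by (rule card_bounded_monomials)
  also have "\<dots> \<le> ((k * L + 1) * B) ^ n"
    using B0 by (intro power_mono) (auto simp: algebra_simps)
  also have "\<dots> = (k * L + 1) ^ n * B ^ n" by (rule power_mult_distrib)
  also have "\<dots> < B * B ^ n" using B0 by (intro mult_strict_right_mono) (auto simp: B_def)
  also have "\<dots> = B ^ Suc n" by simp
  also have "\<dots> \<le> B ^ k" using nk B0 by (intro power_increasing) auto
  finally have "card S < card {..<B ^ k}" by simp
  then obtain c where c: "\<exists>e\<in>{..<B ^ k}. c e \<noteq> 0"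
    "\<And>m. m \<in> S \<Longrightarrow> (\<Sum>e<B ^ k. c e * Poly_Mapping.lookup (G e) m) = 0"
    using homogeneous_system_nontrivial_solution[of S "{..<B ^ k}" "\<lambda>e m. Poly_Mapping.lookup (G e) m"]
      card_bounded_monomials(1)[of n "k * (B * L)"] unfolding S_def by blast
  have lookup: "Poly_Mapping.lookup (mpoly_const a * p) m = a * Poly_Mapping.lookup p m" for a and p :: "'k mpoly" and m
    by (simp add: mpoly_const_def flip: mult_map_scale_conv_mult) (simp add: map.rep_eq when_def)
  have "(\<Sum>e<B ^ k. mpoly_const (c e) * G e) = 0"
  proof (rule poly_mapping_eqI)
    fix m
    have "(\<Sum>e<B ^ k. c e * Poly_Mapping.lookup (G e) m) = 0"
    proof (cases "m \<in> S")
      case False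
      then have "Poly_Mapping.lookup (G e) m = 0" for e
        using G[of e] by (metis in_keys_iff subsetD)
      then show ?thesis by simp
    qed (rule c(2))
    then show "Poly_Mapping.lookup (\<Sum>e<B ^ k. mpoly_const (c e) * G e) m = Poly_Mapping.lookup 0 m"
      by (simp add: lookup_sum lookup)
  qed
  then show ?thesis using that[OF B0] c(1) by (auto simp: G_def)
qed

text \<open>Pulled back along \<open>X\<close>, the polynomials that separate the members of a chain
  live in \<open>n\<close> variables. More than \<open>n\<close> of them satisfy a relation, and its
  evaluation at parameters of points of the top member contradicts their independence there.\<close>

lemma alg_dim_le_parametrization:
  fixes V :: "(nat \<Rightarrow> 'k::field) set"
  assumes X: "\<And>i. i \<in> {1..N} \<Longrightarrow> X i \<in> mpoly_ring n"
    and V: "\<And>x. x \<in> V \<Longrightarrow> \<exists>u. \<forall>i\<in>{1..N}. x i = eval_mpoly u (X i)"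
  shows "alg_dim N V \<le> enat n"
  unfolding alg_dim_def
proof (rule Sup_least)
  fix y assume "y \<in> {enat k | k. \<exists>Z :: nat \<Rightarrow> (nat \<Rightarrow> 'k) set.
     (\<forall>i \<le> k. irreducible_algebraic_set N (Z i) \<and> Z i \<subseteq> V) \<and> (\<forall>i < k. Z i \<subset> Z (Suc i))}"
  then obtain k and Z :: "nat \<Rightarrow> (nat \<Rightarrow> 'k) set" where y: "y = enat k"
    and Z: "\<And>i. i \<le> k \<Longrightarrow> irreducible_algebraic_set N (Z i)" "\<And>i. i \<le> k \<Longrightarrow> Z i \<subseteq> V"
      "\<And>i. i < k \<Longrightarrow> Z i \<subset> Z (Suc i)" by blast
  have "\<exists>f\<in>mpoly_ring N. (\<forall>x\<in>Z i. eval_mpoly x f = 0) \<and> (\<exists>x\<in>Z (Suc i). eval_mpoly x f \<noteq> 0)"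
    if i: "i < k" for i
  proof -
    obtain F where F: "F \<subseteq> mpoly_ring N" "Z i = zero_set N F"
      using Z(1)[of i] i by (auto simp: irreducible_algebraic_set_def algebraic_set_def)
    obtain x where x: "x \<in> Z (Suc i)" "x \<notin> Z i" using Z(3)[OF i] by blast
    have "x \<in> affine_space N"
      using Z(1)[of "Suc i"] i x(1) algebraic_set_subset by (auto simp: irreducible_algebraic_set_def)
    then obtain f where "f \<in> F" "eval_mpoly x f \<noteq> 0" using x F by (auto simp: zero_set_def)
    then show ?thesis using F x by (auto simp: zero_set_def intro!: bexI[of _ f])
  qed
  then obtain f where f: "\<And>i. i < k \<Longrightarrow> f i \<in> mpoly_ring N"
    "\<And>i x. i < k \<Longrightarrow> x \<in> Z i \<Longrightarrow> eval_mpoly x (f i) = 0"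
    "\<And>i. i < k \<Longrightarrow> \<exists>x\<in>Z (Suc i). eval_mpoly x (f i) \<noteq> 0" by metis
  have "k \<le> n"
  proof (rule ccontr)
    assume "\<not> k \<le> n"
    then have nk: "n < k" by simp
    let ?g = "\<lambda>i. subst_mpoly mpoly_const X (f i)"
    have g: "?g i \<in> mpoly_ring n" if "i < k" for i
      using f(1)[OF that] X by (rule subst_mpoly_in_ring)
    obtain B c e where B: "B > 0" "e < B ^ k" "c e \<noteq> 0"
      and 0: "(\<Sum>e<B ^ k. mpoly_const (c e) * (\<Prod>i<k. ?g i ^ (e div B ^ i mod B))) = 0"
      by (rule mpolys_algebraically_dependent[of k ?g n, OF g nk])
    have "(\<Sum>e<B ^ k. c e * (\<Prod>i<k. eval_mpoly x (f i) ^ (e div B ^ i mod B))) = 0" if x: "x \<in> Z k" for x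
    proof -
      obtain u where u: "\<And>i. i \<in> {1..N} \<Longrightarrow> eval_mpoly u (X i) = x i" using V Z(2)[of k] x by fastforce
      have "eval_mpoly u (?g i) = eval_mpoly x (f i)" if "i < k" for i
        by (rule hom_subst_mpoly[OF comm_ring_hom_eval_mpoly _ f(1)[OF that]]) (use u in auto)
      then show ?thesis
        using arg_cong[OF 0, of "eval_mpoly u"]
        by (simp add: eval_mpoly.hom_sum eval_mpoly.hom_mult eval_mpoly.hom_prod eval_mpoly.hom_power)
    qed
    from chain_algebraically_independent[OF Z(1) _ f this B(2,1)] show False
      using Z(3) B(3) by blast
  qed
  then show "y \<le> enat n" by (simp add: y)
qed

section \<open>Equations of the toric variety\<close>

lemma toric_varietyI:
  assumes "x \<in> affine_space (n + 2)" "\<And>i. i \<in> {1..n} \<Longrightarrow> x i = u i ^ d"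
    "x (n + 1) = (\<Prod>i=1..n. u i ^ a i)" "x (n + 2) = (\<Prod>i=1..n. u i ^ b i)"
  shows "x \<in> simplicial_toric_variety n d a b"
  unfolding simplicial_toric_variety_def
  using assms by (auto simp: affine_space_def intro!: bexI[of _ "restrict u {1..n}"])

lemma toric_varietyE:
  assumes "x \<in> simplicial_toric_variety n d a b"
  obtains u where "x \<in> affine_space (n + 2)" "\<And>i. i \<in> {1..n} \<Longrightarrow> x i = u i ^ d"
    "x (n + 1) = (\<Prod>i=1..n. u i ^ a i)" "x (n + 2) = (\<Prod>i=1..n. u i ^ b i)"
  using assms unfolding simplicial_toric_variety_def by blast

lemma toric_coordinate_cases:
  fixes n :: nat
  assumes "i \<in> {1..n + 2}"
  obtains "i \<in> {1..n}" | "i = n + 1" | "i = n + 2"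
  using assms by force

lemma prod_power_commute:
  fixes u :: "nat \<Rightarrow> 'k::comm_ring_1"
  shows "(\<Prod>i\<in>A. u i ^ a i) ^ d = (\<Prod>i\<in>A. (u i ^ d) ^ a i)"
  by (simp add: prod_power_distrib mult.commute flip: power_mult)

lemma alg_dim_toric_le: "alg_dim (n + 2) (simplicial_toric_variety n d a b) \<le> enat n"
proof (rule alg_dim_le_parametrization)
  let ?X = "\<lambda>i. if i \<in> {1..n} then mpoly_var i ^ d
    else \<Prod>k=1..n. mpoly_var k ^ (if i = n + 1 then a k else b k) :: 'a mpoly"
  show "?X i \<in> mpoly_ring n" for i
    by (auto intro!: mpoly_ring_power mpoly_ring_prod mpoly_ring_var)
  fix x :: "nat \<Rightarrow> 'a" assume "x \<in> simplicial_toric_variety n d a b"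
  then obtain u where u: "\<And>i. i \<in> {1..n} \<Longrightarrow> x i = u i ^ d"
    "x (n + 1) = (\<Prod>i=1..n. u i ^ a i)" "x (n + 2) = (\<Prod>i=1..n. u i ^ b i)" by (rule toric_varietyE) blast
  have "x i = eval_mpoly u (?X i)" if "i \<in> {1..n + 2}" for i
    using that u
    by (cases rule: toric_coordinate_cases) (simp_all add: eval_mpoly.hom_power eval_mpoly.hom_prod)
  then show "\<exists>u. \<forall>i\<in>{1..n + 2}. x i = eval_mpoly u (?X i)" by blast
qed

lemma alg_dim_toric_ge:
  fixes V :: "(nat \<Rightarrow> 'k::alg_closed_field) set"
  assumes V: "V = simplicial_toric_variety n d a b" "algebraic_set (n + 2) V" and d: "d > 0"
  shows "enat n \<le> alg_dim (n + 2) V"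
proof -
  \<comment> \<open>The images of the coordinate subspaces in which only the first \<open>j\<close>
    parameters are free.\<close>
  define Z where "Z j = {x \<in> V. \<forall>i\<in>{Suc j..n}. x i = 0}" for j
  have pt: "(\<lambda>i\<in>{1..n+2}. if i \<le> n then u i ^ d else \<Prod>k=1..n. u k ^ (if i = n + 1 then a k else b k)) \<in> V"
    for u :: "nat \<Rightarrow> 'k"
    unfolding V(1) by (rule toric_varietyI[of _ n u]) (auto simp: affine_space_def)
  have "irreducible_algebraic_set (n + 2) (Z j)" for j
  proof (rule irreducible_algebraic_setI)
    have "Z j = V \<inter> zero_set (n + 2) (mpoly_var ` {Suc j..n})"
      using algebraic_set_subset[OF V(2)] by (auto simp: Z_def zero_set_def)
    also have "algebraic_set (n + 2) \<dots>"
      by (intro algebraic_set_Int V(2) algebraic_set_zero_set) (auto intro!: mpoly_ring_var)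
    finally show "algebraic_set (n + 2) (Z j)" .
    show "Z j \<noteq> {}"
      using pt[of "\<lambda>_. 0"] d by (auto simp: Z_def zero_power)
  next
    fix x y assume x: "x \<in> Z j" and y: "y \<in> Z j"
    have xV: "x \<in> simplicial_toric_variety n d a b" and yV: "y \<in> simplicial_toric_variety n d a b"
      using x y by (auto simp: Z_def V(1))
    obtain u where u: "\<And>i. i \<in> {1..n} \<Longrightarrow> x i = u i ^ d"
      "x (n + 1) = (\<Prod>i=1..n. u i ^ a i)" "x (n + 2) = (\<Prod>i=1..n. u i ^ b i)" using xV by (rule toric_varietyE) blast
    obtain v where v: "\<And>i. i \<in> {1..n} \<Longrightarrow> y i = v i ^ d"
      "y (n + 1) = (\<Prod>i=1..n. v i ^ a i)" "y (n + 2) = (\<Prod>i=1..n. v i ^ b i)" using yV by (rule toric_varietyE) blast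
    have uv0: "u i = 0 \<and> v i = 0" if "i \<in> {Suc j..n}" for i
      using that x y u(1)[of i] v(1)[of i] by (auto simp: Z_def)
    \<comment> \<open>The straight line between two parameter points stays in the coordinate
      subspace, since \<open>u\<close> and \<open>v\<close> both vanish beyond \<open>j\<close>; its
      image is the curve required for irreducibility.\<close>
    define L where "L i = [:u i, v i - u i:]" for i
    define X where "X i = (if i \<le> n then L i ^ d else \<Prod>k=1..n. L k ^ (if i = n + 1 then a k else b k))" for i
    have polyX: "poly (X i) t = (if i \<le> n then poly (L i) t ^ d
        else \<Prod>k=1..n. poly (L k) t ^ (if i = n + 1 then a k else b k))" for i t
      by (simp add: X_def poly_prod)
    have "poly (X i) 0 = x i \<and> poly (X i) 1 = y i" if "i \<in> {1..n + 2}" for i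
      using that u v by (cases rule: toric_coordinate_cases) (simp_all add: polyX L_def)
    moreover have "(\<lambda>i\<in>{1..n + 2}. poly (X i) t) \<in> Z j" for t
      using pt[of "\<lambda>i. poly (L i) t"] uv0 d unfolding Z_def polyX by (auto simp: L_def)
    ultimately show "\<exists>X. (\<forall>i\<in>{1..n + 2}. poly (X i) 0 = x i \<and> poly (X i) 1 = y i) \<and>
      (\<forall>t. (\<lambda>i\<in>{1..n + 2}. poly (X i) t) \<in> Z j)" by blast
  qed
  moreover have "Z j \<subset> Z (Suc j)" if "j < n" for j
  proof
    show "Z j \<subseteq> Z (Suc j)" by (auto simp: Z_def)
    \<comment> \<open>The image of the unit vector in direction \<open>Suc j\<close>.\<close>
    let ?x = "(\<lambda>i\<in>{1..n+2}. if i \<le> n then (if i = Suc j then 1 else 0) ^ d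
      else \<Prod>k=1..n. (if k = Suc j then 1 else 0) ^ (if i = n + 1 then a k else b k)) :: nat \<Rightarrow> 'k"
    have "?x \<in> Z (Suc j)" using pt[of "\<lambda>i. if i = Suc j then 1 else 0"] d by (auto simp: Z_def)
    moreover have "?x \<notin> Z j" using that by (auto simp: Z_def)
    ultimately show "Z j \<noteq> Z (Suc j)" by blast
  qed
  moreover have "Z j \<subseteq> V" for j by (auto simp: Z_def)
  ultimately show ?thesis unfolding alg_dim_def by (intro Sup_upper) blast
qed

lemma alg_codim_toric:
  fixes V :: "(nat \<Rightarrow> 'k::alg_closed_field) set"
  assumes "V = simplicial_toric_variety n d a b" "algebraic_set (n + 2) V" "d > 0"
  shows "alg_codim (n + 2) V = 2"
proof -
  have "alg_dim (n + 2) V = enat n"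
    using alg_dim_toric_ge[OF assms] alg_dim_toric_le[of n d a b] assms(1) by (auto intro: antisym)
  then show ?thesis by (simp add: alg_codim_def numeral_eq_enat)
qed

section \<open>Sets of two and three defining equations\<close>

definition binomial_equation :: "nat \<Rightarrow> nat \<Rightarrow> (nat \<Rightarrow> nat) \<Rightarrow> nat \<Rightarrow> 'k::field mpoly" where
  "binomial_equation n d a j = mpoly_var j ^ d - (\<Prod>i=1..n. mpoly_var i ^ a i)"

lemma binomial_equation_in_ring:
  "j \<in> {1..n + 2} \<Longrightarrow> binomial_equation n d a j \<in> mpoly_ring (n + 2)"
  unfolding binomial_equation_def by (auto intro!: mpoly_ring_intros)

lemma eval_binomial_equation:
  "eval_mpoly x (binomial_equation n d a j) = x j ^ d - (\<Prod>i=1..n. x i ^ a i)"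
  by (simp add: binomial_equation_def eval_mpoly.hom_minus eval_mpoly.hom_power eval_mpoly.hom_prod)

lemma toric_variety_satisfies_binomial_equations:
  assumes "x \<in> simplicial_toric_variety n d a b"
  shows "x (n + 1) ^ d = (\<Prod>i=1..n. x i ^ a i)" "x (n + 2) ^ d = (\<Prod>i=1..n. x i ^ b i)"
proof -
  obtain u where "\<And>i. i \<in> {1..n} \<Longrightarrow> x i = u i ^ d"
    "x (n + 1) = (\<Prod>i=1..n. u i ^ a i)" "x (n + 2) = (\<Prod>i=1..n. u i ^ b i)"
    using assms by (rule toric_varietyE) blast
  then show "x (n + 1) ^ d = (\<Prod>i=1..n. x i ^ a i)" "x (n + 2) ^ d = (\<Prod>i=1..n. x i ^ b i)"
    by (simp_all add: prod_power_commute)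
qed

lemma root_of_unity_power_cong:
  fixes x :: "'k::comm_monoid_mult"
  assumes "x ^ d = 1" "[k = m] (mod d)"
  shows "x ^ k = x ^ m"
proof -
  obtain p q where "m + p * d = k + q * d" using assms(2) by (auto simp: cong_iff_lin_nat)
  then have "x ^ (m + d * p) = x ^ (k + d * q)" by (simp add: mult.commute)
  then show ?thesis by (simp add: power_add power_mult assms(1))
qed

lemma exists_roots:
  fixes x :: "nat \<Rightarrow> 'k::alg_closed_field"
  assumes "d > 0"
  obtains u where "\<And>i. u i ^ d = x i"
proof -
  have "\<forall>i. \<exists>y. y ^ d = x i" using nth_root_exists[OF assms] by blast
  then show ?thesis using that by metis
qed

text \<open>Two \<open>d\<close>-th roots of the same element differ by a \<open>d\<close>-th root of unity, which is absorbed
  into the coordinate \<open>u l\<close>.\<close>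

lemma adjust_roots:
  fixes u :: "nat \<Rightarrow> 'k::field"
  assumes l: "l \<in> {1..n}" "gcd d (a l) = 1" and d: "d > 0"
    and y: "y ^ d = (\<Prod>i=1..n. (u i ^ d) ^ a i)"
  obtains v where "\<And>i. v i ^ d = u i ^ d" "y = (\<Prod>i=1..n. v i ^ a i)"
proof (cases "(\<Prod>i=1..n. u i ^ a i) = 0")
  case True
  have "y ^ d = (\<Prod>i=1..n. u i ^ a i) ^ d"
    using y by (simp add: prod_power_commute)
  then have "y = (\<Prod>i=1..n. u i ^ a i)" by (metis True d power_eq_0_iff zero_power)
  then show ?thesis using that[of u] by blast
next
  case False
  define q where "q = (\<Prod>i=1..n. u i ^ a i)"
  define \<zeta> where "\<zeta> = y / q"
  have "y ^ d = q ^ d"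
    using y by (simp add: q_def prod_power_commute)
  then have \<zeta>: "\<zeta> ^ d = 1" "y = \<zeta> * q" using False by (simp_all add: \<zeta>_def q_def power_divide)
  have "Rings.coprime (a l) d" using l(2) by (simp add: coprime_iff_gcd_eq_1 gcd.commute)
  \<comment> \<open>With an inverse \<open>s\<close> of \<open>a l\<close> modulo \<open>d\<close>,
    multiplying \<open>u l\<close> by \<open>\<zeta> ^ s\<close> multiplies the monomial by
    \<open>\<zeta>\<close> and leaves all \<open>d\<close>-th powers unchanged.\<close>
  then obtain s where "[a l * s = 1] (mod d)" using cong_solve_coprime_nat by auto
  then have s: "\<zeta> ^ (s * a l) = \<zeta>"
    using root_of_unity_power_cong[OF \<zeta>(1), of "a l * s" 1] by (simp add: mult.commute)
  define v where "v = u(l := \<zeta> ^ s * u l)"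
  have "(\<Prod>i=1..n. v i ^ a i) = v l ^ a l * (\<Prod>i\<in>{1..n} - {l}. v i ^ a i)"
    using l(1) by (simp add: prod.remove)
  also have "\<dots> = \<zeta> * (u l ^ a l * (\<Prod>i\<in>{1..n} - {l}. u i ^ a i))"
    using s by (simp add: v_def power_mult_distrib flip: power_mult)
  also have "\<dots> = y" using l(1) by (simp add: \<zeta>(2) q_def prod.remove)
  finally have "y = (\<Prod>i=1..n. v i ^ a i)" ..
  moreover have "v i ^ d = u i ^ d" for i
    using \<zeta>(1) by (simp add: v_def power_mult_distrib) (metis mult.commute power_mult power_one)
  ultimately show ?thesis using that by blast
qed

text \<open>The third relation says nothing where both its sides vanish. But a zero coordinate
  \<open>x k\<close> makes one of the two monomials vanish for every choice of roots, because
  \<open>a k\<close> or \<open>b k\<close> is nonzero; the other monomial is then matched by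
  changing the root at \<open>l\<close>, for which the binomial equations suffice. Where no
  coordinate is zero, the third relation can be divided out.\<close>

lemma toric_variety_three_equations:
  fixes V :: "(nat \<Rightarrow> 'k::alg_closed_field) set"
  assumes V: "V = simplicial_toric_variety n d a b" and d: "d > 0"
    and nonzero: "\<And>i. i \<in> {1..n} \<Longrightarrow> a i \<noteq> 0 \<or> b i \<noteq> 0"
    and cong: "\<And>i. i \<in> {1..n} \<Longrightarrow> [b i = c * a i] (mod d)"
    and l: "l \<in> {1..n}" "gcd d (a l) = 1" "gcd d (b l) = 1"
  obtains F where "finite F" "card F \<le> 3" "F \<subseteq> mpoly_ring (n + 2)" "zero_set (n + 2) F = V"
proof -
  \<comment> \<open>\<open>p i - q i\<close> is the exponent of \<open>x i\<close> in the Laurent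
    relation between the two monomials; splitting it makes \<open>F3\<close> a polynomial.\<close>
  have "\<forall>i. \<exists>p q. i \<in> {1..n} \<longrightarrow> b i + q * d = c * a i + p * d"
    using cong by (metis cong_iff_lin_nat cong_sym)
  then obtain p q where pq: "\<And>i. i \<in> {1..n} \<Longrightarrow> b i + q i * d = c * a i + p i * d" by metis
  define F3 :: "'k mpoly" where "F3 = mpoly_var (n + 2) * (\<Prod>i=1..n. mpoly_var i ^ q i) -
      mpoly_var (n + 1) ^ c * (\<Prod>i=1..n. mpoly_var i ^ p i)"
  define F where "F = {binomial_equation n d a (n + 1), binomial_equation n d b (n + 2), F3}"
  have "F \<subseteq> mpoly_ring (n + 2)"
    using binomial_equation_in_ring[of "n + 1" n d a] binomial_equation_in_ring[of "n + 2" n d b]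
    by (auto simp: F_def F3_def intro!: mpoly_ring_intros)
  moreover have "card F \<le> 3" by (simp add: F_def card_insert_if)
  moreover have "finite F" by (simp add: F_def)
  moreover have "zero_set (n + 2) F = V"
  proof (intro equalityI subsetI)
    have F: "x \<in> zero_set (n + 2) F \<longleftrightarrow> x \<in> affine_space (n + 2) \<and>
        x (n + 1) ^ d = (\<Prod>i=1..n. x i ^ a i) \<and> x (n + 2) ^ d = (\<Prod>i=1..n. x i ^ b i) \<and>
        x (n + 2) * (\<Prod>i=1..n. x i ^ q i) = x (n + 1) ^ c * (\<Prod>i=1..n. x i ^ p i)" for x
      by (simp add: zero_set_def F_def F3_def eval_binomial_equation eval_mpoly.hom_minus
          eval_mpoly.hom_mult eval_mpoly.hom_power eval_mpoly.hom_prod)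
    have third: "(\<Prod>i=1..n. u i ^ b i) * (\<Prod>i=1..n. (u i ^ d) ^ q i) =
        (\<Prod>i=1..n. u i ^ a i) ^ c * (\<Prod>i=1..n. (u i ^ d) ^ p i)" for u :: "nat \<Rightarrow> 'k"
    proof -
      have "(\<Prod>i=1..n. u i ^ b i) * (\<Prod>i=1..n. (u i ^ d) ^ q i) = (\<Prod>i=1..n. u i ^ (b i + q i * d))"
        by (simp add: prod.distrib power_add mult.commute flip: power_mult)
      also have "\<dots> = (\<Prod>i=1..n. u i ^ (c * a i + p i * d))" using pq by (intro prod.cong) auto
      also have "\<dots> = (\<Prod>i=1..n. u i ^ a i) ^ c * (\<Prod>i=1..n. (u i ^ d) ^ p i)"
        by (simp add: prod.distrib power_add prod_power_distrib mult.commute flip: power_mult)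
      finally show ?thesis .
    qed
    fix x
    {
      assume x: "x \<in> V"
      then obtain u where u: "x \<in> affine_space (n + 2)" "\<And>i. i \<in> {1..n} \<Longrightarrow> x i = u i ^ d"
        "x (n + 1) = (\<Prod>i=1..n. u i ^ a i)" "x (n + 2) = (\<Prod>i=1..n. u i ^ b i)"
        unfolding V by (rule toric_varietyE) blast
      then show "x \<in> zero_set (n + 2) F"
        using third[of u] unfolding F by (simp add: prod_power_commute)
    }
    assume x: "x \<in> zero_set (n + 2) F"
    then have aff: "x \<in> affine_space (n + 2)"
      and y1: "x (n + 1) ^ d = (\<Prod>i=1..n. x i ^ a i)" and y2: "x (n + 2) ^ d = (\<Prod>i=1..n. x i ^ b i)"
      and y3: "x (n + 2) * (\<Prod>i=1..n. x i ^ q i) = x (n + 1) ^ c * (\<Prod>i=1..n. x i ^ p i)"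
      unfolding F by blast+
    obtain u where u: "\<And>i. u i ^ d = x i" using exists_roots[OF d] by metis
    have y1': "x (n + 1) ^ d = (\<Prod>i=1..n. (u i ^ d) ^ a i)" and y2': "x (n + 2) ^ d = (\<Prod>i=1..n. (u i ^ d) ^ b i)"
      using y1 y2 by (simp_all add: u)
    have zero: "(\<Prod>i=1..n. v i ^ e i) = 0" if "x k = 0" "k \<in> {1..n}" "e k \<noteq> 0" "\<And>i. v i ^ d = u i ^ d"
      for v e k
    proof -
      have "v k = 0" using that(1) that(4)[of k] u[of k] d by simp
      then show ?thesis using that(2,3) by (intro prod_zero) auto
    qed
    consider k where "k \<in> {1..n}" "x k = 0" "a k \<noteq> 0" | k where "k \<in> {1..n}" "x k = 0" "b k \<noteq> 0"
      | "\<And>k. k \<in> {1..n} \<Longrightarrow> x k \<noteq> 0" using nonzero by blast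
    then show "x \<in> V"
    proof cases
      case 1
      obtain v where v: "\<And>i. v i ^ d = u i ^ d" "x (n + 2) = (\<Prod>i=1..n. v i ^ b i)"
        using adjust_roots[where a = b, OF l(1,3) d y2'] by blast
      have "(\<Prod>i=1..n. v i ^ a i) = 0" using 1 v(1) by (intro zero)
      moreover have "x (n + 1) ^ d = 0" unfolding y1 using 1 by (intro prod_zero) auto
      ultimately show ?thesis
        unfolding V using v u aff d by (intro toric_varietyI[of _ n v]) auto
    next
      case 2
      obtain v where v: "\<And>i. v i ^ d = u i ^ d" "x (n + 1) = (\<Prod>i=1..n. v i ^ a i)"
        using adjust_roots[where a = a, OF l(1,2) d y1'] by blast
      have "(\<Prod>i=1..n. v i ^ b i) = 0" using 2 v(1) by (intro zero)
      moreover have "x (n + 2) ^ d = 0" unfolding y2 using 2 by (intro prod_zero) auto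
      ultimately show ?thesis
        unfolding V using v u aff d by (intro toric_varietyI[of _ n v]) auto
    next
      case 3
      obtain v where v: "\<And>i. v i ^ d = u i ^ d" "x (n + 1) = (\<Prod>i=1..n. v i ^ a i)"
        using adjust_roots[where a = a, OF l(1,2) d y1'] by blast
      have "x (n + 2) * (\<Prod>i=1..n. x i ^ q i) = (\<Prod>i=1..n. v i ^ b i) * (\<Prod>i=1..n. x i ^ q i)"
        using third[of v] y3 unfolding v(2)[symmetric] v(1) u by simp
      moreover have "(\<Prod>i=1..n. x i ^ q i) \<noteq> 0" using 3 by simp
      ultimately have "x (n + 2) = (\<Prod>i=1..n. v i ^ b i)" using mult_right_cancel by blast
      then show ?thesis
        unfolding V using v u aff by (intro toric_varietyI[of _ n v]) auto
    qed
  qed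
  ultimately show ?thesis using that by blast
qed

lemma power_char_power_inject:
  fixes x y :: "'k::field"
  assumes "prime CHAR('k)" "d = CHAR('k) ^ r" "x ^ d = y ^ d"
  shows "x = y"
proof -
  have "x ^ d = ((x - y) + y) ^ d" by simp
  also have "\<dots> = (x - y) ^ d + y ^ d" by (rule freshmans_dream'[OF assms(1,2)])
  finally have "(x - y) ^ d = 0" using assms(3) by simp
  then show ?thesis by simp
qed

lemma toric_variety_two_equations:
  fixes V :: "(nat \<Rightarrow> 'k::alg_closed_field) set"
  assumes V: "V = simplicial_toric_variety n d a b"
    and d: "prime CHAR('k)" "d = CHAR('k) ^ r"
  obtains F where "finite F" "card F \<le> 2" "F \<subseteq> mpoly_ring (n + 2)" "zero_set (n + 2) F = V"
proof -
  have "d > 0" using d prime_gt_0_nat by simp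
  define F :: "'k mpoly set" where "F = {binomial_equation n d a (n + 1), binomial_equation n d b (n + 2)}"
  have "F \<subseteq> mpoly_ring (n + 2)"
    using binomial_equation_in_ring[of "n + 1" n d a] binomial_equation_in_ring[of "n + 2" n d b]
    by (simp add: F_def)
  moreover have "card F \<le> 2" by (simp add: F_def card_insert_if)
  moreover have "finite F" by (simp add: F_def)
  moreover have "zero_set (n + 2) F = V"
  proof (intro equalityI subsetI)
    fix x
    {
      assume x: "x \<in> V"
      then have "x \<in> affine_space (n + 2)" unfolding V by (rule toric_varietyE)
      then show "x \<in> zero_set (n + 2) F"
        using toric_variety_satisfies_binomial_equations[OF x[unfolded V]]
        by (simp add: zero_set_def F_def V eval_binomial_equation)
    }
    assume x: "x \<in> zero_set (n + 2) F"
    obtain u where u: "\<And>i. u i ^ d = x i" using exists_roots[OF \<open>d > 0\<close>] by metis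
    have root: "(\<Prod>i=1..n. x i ^ e i) = (\<Prod>i=1..n. u i ^ e i) ^ d" for e
      by (simp add: prod_power_distrib mult.commute flip: u power_mult)
    have "x (n + 1) ^ d = (\<Prod>i=1..n. u i ^ a i) ^ d" "x (n + 2) ^ d = (\<Prod>i=1..n. u i ^ b i) ^ d"
      using x unfolding root[symmetric] by (simp_all add: zero_set_def F_def eval_binomial_equation)
    from this[THEN power_char_power_inject[OF d]]
    have "x (n + 1) = (\<Prod>i=1..n. u i ^ a i)" "x (n + 2) = (\<Prod>i=1..n. u i ^ b i)" .
    then show "x \<in> V"
      unfolding V using x u by (intro toric_varietyI[of _ n u]) (auto simp: zero_set_def)
  qed
  ultimately show ?thesis using that by blast
qed

text \<open>Both entries of column \<open>l\<close> are units modulo \<open>d\<close>, so the factor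
  is a unit too. It can therefore be inverted when (C) presents the first row as a multiple of the
  second.\<close>

lemma proportional_rows_mod_coprime:
  assumes d: "d > 1" and C: "proportional_rows_mod n d a b"
    and l: "l \<in> {1..n}" "gcd d (a l) = 1" "gcd d (b l) = 1"
  obtains c where "gcd d c = 1" "\<And>i. i \<in> {1..n} \<Longrightarrow> [b i = c * a i] (mod d)"
proof -
  \<comment> \<open>Local to arbitrary rows, because it is applied with \<open>a\<close> and
    \<open>b\<close> in either order.\<close>
  have nat: "\<exists>c. gcd d c = 1 \<and> (\<forall>i\<in>{1..n}. [b i = c * a i] (mod d))"
    if c: "\<And>i. i \<in> {1..n} \<Longrightarrow> [int (b i) = c * int (a i)] (mod int d)" and bl: "gcd d (b l) = 1"
    for c :: int and a b
  proof -
    define c' where "c' = nat (c mod int d)"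
    have "int c' = c mod int d" using d by (simp add: c'_def)
    then have "[c = int c'] (mod int d)" by (simp add: cong_def)
    then have "[int (b i) = int (c' * a i)] (mod int d)" if "i \<in> {1..n}" for i
      using c[OF that] by (metis cong_scalar_right cong_trans of_nat_mult)
    then have c': "[b i = c' * a i] (mod d)" if "i \<in> {1..n}" for i
      using that by (simp only: cong_int_iff)
    have "gcd d (c' * a l) = 1"
      using cong_gcd_eq[OF c'[OF l(1)]] bl by (metis gcd.commute)
    then have "gcd d c' = 1" by (metis coprime_iff_gcd_eq_1 coprime_mult_right_iff)
    then show ?thesis using c' by (intro exI[of _ c'] conjI ballI)
  qed
  from C[unfolded proportional_rows_mod_def] show ?thesis
  proof
    assume "\<exists>c. \<forall>i\<in>{1..n}. [int (b i) = c * int (a i)] (mod int d)"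
    then obtain c where "\<And>i. i \<in> {1..n} \<Longrightarrow> [int (b i) = c * int (a i)] (mod int d)" by blast
    from nat[of b c a, OF this l(3)] that show ?thesis by metis
  next
    assume "\<exists>c. \<forall>i\<in>{1..n}. [int (a i) = c * int (b i)] (mod int d)"
    then obtain c' where "\<And>i. i \<in> {1..n} \<Longrightarrow> [int (a i) = c' * int (b i)] (mod int d)" by blast
    from nat[of a c' b, OF this l(2)]
    obtain c where c: "gcd d c = 1" "\<And>i. i \<in> {1..n} \<Longrightarrow> [a i = c * b i] (mod d)" by metis
    have "Rings.coprime c d" using c(1) by (simp add: coprime_iff_gcd_eq_1 gcd.commute)
    then obtain s where s: "[c * s = 1] (mod d)" using cong_solve_coprime_nat by auto
    have "Rings.coprime s d"
      using s unfolding coprime_iff_invertible_nat by (auto simp: mult.commute)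
    then have "gcd d s = 1" by (simp add: coprime_iff_gcd_eq_1 gcd.commute)
    moreover have "[b i = s * a i] (mod d)" if "i \<in> {1..n}" for i
    proof -
      have "[s * a i = s * (c * b i)] (mod d)" using c(2)[OF that] by (rule cong_scalar_left)
      also have "s * (c * b i) = c * s * b i" by simp
      also have "[c * s * b i = 1 * b i] (mod d)" using s by (rule cong_scalar_right)
      finally show ?thesis by (simp add: cong_sym)
    qed
    ultimately show ?thesis by (rule that)
  qed
qed

section \<open>Surfaces in four-space that meet in one point\<close>

lemma degree_0_if_no_root:
  fixes p :: "'k::alg_closed_field poly"
  assumes "\<And>x. poly p x \<noteq> 0"
  obtains c where "p = [:c:]" "c \<noteq> 0"
proof -
  have "degree p = 0" using alg_closed_imp_poly_has_root[of p] assms by blast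
  then obtain c where "p = [:c:]" by (elim degree_eq_zeroE)
  then show ?thesis using that assms[of 0] by auto
qed

lemma poly_map_poly_eq_0_imp:
  fixes \<phi> :: "'a::comm_ring_1 \<Rightarrow> 'k::alg_closed_field"
  assumes \<phi>: "\<phi> 0 = 0" and A: "finite A" "\<And>c. c \<notin> A \<Longrightarrow> poly (map_poly \<phi> p) c = 0"
  shows "\<phi> (coeff p i) = 0"
proof -
  have "map_poly \<phi> p = 0" using poly_eq_0_if_cofinitely[OF A] .
  then show ?thesis using coeff_map_poly[of \<phi> p i, OF \<phi>] by simp
qed

lemma eval2_eq_0_imp:
  fixes g :: "'k::alg_closed_field poly poly"
  assumes "finite A" "\<And>y1 y2. y2 \<notin> A \<Longrightarrow> eval2 y1 y2 g = 0"
  shows "g = 0"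
proof (rule poly_eqI)
  fix i
  have "poly (coeff g i) y1 = 0" for y1
    by (rule poly_map_poly_eq_0_imp[where A = A]) (use assms in auto)
  then show "coeff g i = coeff 0 i" using poly_eq_0_if_cofinitely[of "{}" "coeff g i"] by simp
qed

lemma coeff_eq_0_if_no_root:
  fixes \<phi> :: "'a::comm_ring_1 \<Rightarrow> 'k::alg_closed_field"
  assumes "\<phi> 0 = 0" "\<And>x. poly (map_poly \<phi> p) x \<noteq> 0" "j > 0"
  shows "\<phi> (coeff p j) = 0"
proof -
  obtain c where "map_poly \<phi> p = [:c:]" using degree_0_if_no_root[OF assms(2)] by metis
  then show ?thesis using coeff_map_poly[of \<phi> p j, OF assms(1)] assms(3) by (simp add: coeff_pCons split: nat.splits)
qed

lemma eq_const_if_coeffs_eq_0: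
  assumes "\<And>j. j > 0 \<Longrightarrow> coeff p j = 0"
  shows "p = [:coeff p 0:]"
proof (rule poly_eqI)
  fix j show "coeff p j = coeff [:coeff p 0:] j"
    using assms[of j] by (cases j) simp_all
qed

lemma poly_map_poly_pCons:
  "\<phi> 0 = 0 \<Longrightarrow> poly (map_poly \<phi> (pCons c p)) x = \<phi> c + x * poly (map_poly \<phi> p) x"
  by (simp add: Polynomial.map_poly_pCons)

text \<open>A plane curve is infinite. For \<open>y1\<close> outside \<open>A1\<close> the
  polynomial in \<open>y2\<close> has no root and is thus constant, so the higher coefficients
  vanish at almost all \<open>y1\<close> and are 0; a value of \<open>y2\<close> outside
  \<open>A2\<close> then shows that the remaining coefficient has no root either.\<close>

lemma const_if_few_zeros2:
  fixes H :: "'k::alg_closed_field poly poly"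
  assumes A: "finite A1" "finite A2" and z: "\<And>y1 y2. eval2 y1 y2 H = 0 \<Longrightarrow> y1 \<in> A1 \<and> y2 \<in> A2"
  obtains c where "H = [:[:c:]:]" "c \<noteq> 0"
proof -
  have "coeff H j = 0" if j: "j > 0" for j
  proof (rule poly_eq_0_if_cofinitely[OF A(1)])
    fix y1 assume "y1 \<notin> A1"
    then have "eval2 y1 y2 H \<noteq> 0" for y2 using z by blast
    then show "poly (coeff H j) y1 = 0"
      using coeff_eq_0_if_no_root[of "\<lambda>f. poly f y1" H j] j by simp
  qed
  then have H: "H = [:coeff H 0:]" by (rule eq_const_if_coeffs_eq_0)
  define h where "h = coeff H 0"
  obtain y2 where y2: "y2 \<notin> A2" using ex_new_if_finite[OF infinite_UNIV_alg_closed A(2)] by blast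
  have "poly h y1 \<noteq> 0" for y1
  proof
    assume "poly h y1 = 0"
    then have "eval2 y1 y2 [:h:] = 0"
      using poly_map_poly_pCons[of "\<lambda>f. poly f y1" h 0 y2] by simp
    then have "eval2 y1 y2 H = 0" using H by (simp add: h_def)
    then show False using z y2 by blast
  qed
  then obtain c where "h = [:c:]" "c \<noteq> 0" using degree_0_if_no_root by blast
  then show ?thesis using H that by (simp add: h_def)
qed

text \<open>The zeros are confined to a curve, which is too small to contain a surface in
  three-space. The argument eliminates z first, looking at the points with \<open>y2\<close>
  nonzero.\<close>

lemma const_if_few_zeros3:
  fixes H :: "'k::alg_closed_field poly poly poly"
  assumes d: "d > 0" "\<alpha> > 0"
    and z: "\<And>y1 y2 z. eval3 y1 y2 z H = 0 \<Longrightarrow> y2 = 0 \<and> y1 ^ d = (z ^ \<alpha>) ^ d"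
  obtains c where "H = [:[:[:c:]:]:]" "c \<noteq> 0"
proof -
  interpret eval2: comm_ring_hom "eval2 y1 y2" for y1 y2 :: 'k by (rule comm_ring_hom_eval)
  have "coeff H j = 0" if j: "j > 0" for j
  proof (rule eval2_eq_0_imp[of "{0}"])
    fix y1 y2 :: 'k assume "y2 \<notin> {0}"
    then have "eval3 y1 y2 z H \<noteq> 0" for z using z by blast
    then show "eval2 y1 y2 (coeff H j) = 0"
      using coeff_eq_0_if_no_root[of "eval2 y1 y2" H j] j by simp
  qed simp
  then have H: "H = [:coeff H 0:]" by (rule eq_const_if_coeffs_eq_0)
  define h where "h = coeff H 0"
  have "eval2 y1 y2 h \<noteq> 0" for y1 y2
  proof
    assume "eval2 y1 y2 h = 0"
    then have "eval3 y1 y2 z [:h:] = 0" for z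
      using poly_map_poly_pCons[of "eval2 y1 y2" h 0 z] by simp
    then have "eval3 y1 y2 z H = 0" for z using H by (simp add: h_def)
    \<comment> \<open>Since \<open>h\<close> does not involve z, a zero of it would give zeros of
      \<open>H\<close> at both z = 0 and z = 1, hence the values 0 and 1 for the same
      \<open>y1 ^ d\<close>.\<close>
    then have "y1 ^ d = (0 ^ \<alpha>) ^ d" "y1 ^ d = (1 ^ \<alpha>) ^ d" using z by blast+
    then show False using d by (simp add: zero_power)
  qed
  then obtain c where "h = [:[:c:]:]" "c \<noteq> 0" using const_if_few_zeros2[of "{}" "{}" h] by blast
  then show ?thesis using H that by (simp add: h_def)
qed

text \<open>Vanishing of the first Koszul homology: every syzygy of the pair is a multiple of the
  trivial one. This form, unlike coprimality, can be applied directly to constant coefficients of a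
  relation.\<close>

definition koszul_exact :: "'a::comm_ring_1 \<Rightarrow> 'a \<Rightarrow> bool" where
  "koszul_exact F G \<longleftrightarrow> (\<forall>A B. A * F + B * G = 0 \<longrightarrow> (\<exists>C. A = C * G \<and> B = - C * F))"

lemma koszul_exact_if_no_common_divisor:
  fixes F G :: "'a::ufd"
  assumes "\<And>h. h dvd F \<Longrightarrow> h dvd G \<Longrightarrow> h dvd 1"
  shows "koszul_exact F G"
  unfolding koszul_exact_def
proof (intro allI impI)
  fix A B assume eq: "A * F + B * G = 0"
  have cop: "coprime F G" using assms unfolding coprime_def' by blast
  have eq': "A * F = - B * G" using eq by (simp add: eq_neg_iff_add_eq_0)
  have "G dvd A" using some_gcd.coprime_mult_cross_dvd(2)[OF cop eq'] .
  then obtain C where C: "A = C * G" by (metis dvdE mult.commute)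
  show "\<exists>C. A = C * G \<and> B = - C * F"
  proof (cases "G = 0")
    \<comment> \<open>Cancelling \<open>G\<close> is impossible here; \<open>A\<close> is 0 and
      \<open>C\<close> is read off from \<open>B\<close>.\<close>
    case True
    have "F dvd - B" using some_gcd.coprime_mult_cross_dvd(1)[OF cop eq'] .
    then obtain C' where "- B = C' * F" by (metis dvdE mult.commute)
    then have "B = - C' * F" by (metis minus_minus mult_minus_left)
    then show ?thesis using True C by auto
  next
    case False
    have "(C * F + B) * G = 0" using eq C by (simp add: algebra_simps)
    then have "B = - C * F" using False by (simp add: eq_neg_iff_add_eq_0 add.commute)
    then show ?thesis using C by blast
  qed
qed

lemma coeff_0_eq_0_imp_factor:
  fixes p :: "'a::comm_ring_1 poly"
  assumes "coeff p 0 = 0"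
  obtains q where "p = [:0, 1:] * q"
proof (cases p)
  case (pCons a q)
  then show ?thesis using assms that[of q] by simp
qed

text \<open>At the value 0 of the variable, \<open>A\<close> and \<open>B\<close> give a syzygy of
  the constant coefficients of \<open>F\<close> and \<open>G\<close>, hence a trivial one.
  Subtracting the corresponding trivial syzygy of \<open>F\<close> and \<open>G\<close> makes both
  multipliers divisible by the variable, which can then be cancelled.\<close>

lemma nonzerodivisor_mod_two:
  fixes F G h :: "'a::idom poly"
  assumes K: "koszul_exact (coeff F 0) (coeff G 0)"
    and eq: "[:0, 1:] * h = A * F + B * G"
  obtains A' B' where "h = A' * F + B' * G"
proof -
  have "coeff A 0 * coeff F 0 + coeff B 0 * coeff G 0 = 0"
    using arg_cong[OF eq, of "\<lambda>p. coeff p 0"] by (simp add: coeff_mult_0)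
  then obtain C where C: "coeff A 0 = C * coeff G 0" "coeff B 0 = - C * coeff F 0"
    using K unfolding koszul_exact_def by blast
  obtain A' where A': "A - [:C:] * G = [:0, 1:] * A'"
    by (rule coeff_0_eq_0_imp_factor[of "A - [:C:] * G"]) (use C in \<open>simp_all add: coeff_mult_0\<close>)
  obtain B' where B': "B + [:C:] * F = [:0, 1:] * B'"
    by (rule coeff_0_eq_0_imp_factor[of "B + [:C:] * F"]) (use C in \<open>simp_all add: coeff_mult_0\<close>)
  have "[:0, 1:] * h = (A - [:C:] * G) * F + (B + [:C:] * F) * G"
    unfolding eq by (simp only: algebra_simps)
  also have "\<dots> = [:0, 1:] * (A' * F + B' * G)" unfolding A' B' by (simp only: algebra_simps)
  finally have "h = A' * F + B' * G" by (simp del: mult_pCons_left)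
  then show ?thesis by (rule that)
qed

lemma nonzerodivisor_power_mod_two:
  fixes F G h :: "'a::idom poly"
  assumes K: "koszul_exact (coeff F 0) (coeff G 0)"
    and eq: "[:0, 1:] ^ m * h = A * F + B * G"
  shows "\<exists>A' B'. h = A' * F + B' * G"
  using eq
proof (induction m arbitrary: A B)
  case 0
  then show ?case by auto
next
  case (Suc m)
  then have "[:0, 1:] * ([:0, 1:] ^ m * h) = A * F + B * G" by (simp only: power_Suc mult.assoc)
  then obtain A' B' where "[:0, 1:] ^ m * h = A' * F + B' * G" by (rule nonzerodivisor_mod_two[OF K])
  then show ?case by (rule Suc.IH)
qed

text \<open>The same argument with three generators. Since \<open>t\<close> is a nonzerodivisor
  modulo the constant coefficients of \<open>F\<close> and \<open>G\<close>, every syzygy of these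
  three elements is a combination of the three Koszul ones, with coefficients
  \<open>\<alpha>\<close>, \<open>\<beta>\<close>, \<open>\<gamma>\<close>; \<open>regroup\<close>
  subtracts their lifts.\<close>

lemma nonzerodivisor_mod_three:
  fixes F G h :: "'a::idom poly" and t :: 'a
  assumes K: "koszul_exact (coeff F 0) (coeff G 0)"
    and nzd: "\<forall>C A B. t * C = A * coeff F 0 + B * coeff G 0 \<longrightarrow>
      (\<exists>A' B'. C = A' * coeff F 0 + B' * coeff G 0)"
    and eq: "[:0, 1:] * h = A * F + B * G + D * [:t:]"
  obtains A' B' D' where "h = A' * F + B' * G + D' * [:t:]"
proof -
  let ?A = "coeff A 0" and ?B = "coeff B 0" and ?D = "coeff D 0" and ?F = "coeff F 0" and ?G = "coeff G 0"
  have 0: "?A * ?F + ?B * ?G + ?D * t = 0"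
    using arg_cong[OF eq, of "\<lambda>p. coeff p 0"] by (simp add: coeff_mult_0 mult.commute)
  have "t * ?D = (- ?A) * ?F + (- ?B) * ?G"
    using 0 by (simp add: algebra_simps eq_neg_iff_add_eq_0)
  then obtain \<alpha> \<beta> where D: "?D = \<alpha> * ?F + \<beta> * ?G" using nzd by blast
  have "(?A + \<alpha> * t) * ?F + (?B + \<beta> * t) * ?G = 0"
    using 0 unfolding D by (simp add: algebra_simps)
  then obtain \<gamma> where \<gamma>: "?A + \<alpha> * t = \<gamma> * ?G" "?B + \<beta> * t = - \<gamma> * ?F"
    using K unfolding koszul_exact_def by blast
  have regroup: "A * F + B * G + D * T =
      (A + a * T - g * G) * F + (B + b * T + g * F) * G + (D - a * F - b * G) * T"
    for T a b g :: "'a poly" by (simp add: algebra_simps)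
  obtain A' where A': "A + [:\<alpha>:] * [:t:] - [:\<gamma>:] * G = [:0, 1:] * A'"
    by (rule coeff_0_eq_0_imp_factor[of "A + [:\<alpha>:] * [:t:] - [:\<gamma>:] * G"])
       (use \<gamma>(1) in \<open>simp_all add: coeff_mult_0 mult.commute\<close>)
  obtain B' where B': "B + [:\<beta>:] * [:t:] + [:\<gamma>:] * F = [:0, 1:] * B'"
    by (rule coeff_0_eq_0_imp_factor[of "B + [:\<beta>:] * [:t:] + [:\<gamma>:] * F"])
       (use \<gamma>(2) in \<open>simp_all add: coeff_mult_0 mult.commute\<close>)
  obtain D' where D': "D - [:\<alpha>:] * F - [:\<beta>:] * G = [:0, 1:] * D'"
    by (rule coeff_0_eq_0_imp_factor[of "D - [:\<alpha>:] * F - [:\<beta>:] * G"])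
       (use D in \<open>simp_all add: coeff_mult_0 mult.commute\<close>)
  have "[:0, 1:] * h = (A + [:\<alpha>:] * [:t:] - [:\<gamma>:] * G) * F + (B + [:\<beta>:] * [:t:] + [:\<gamma>:] * F) * G +
      (D - [:\<alpha>:] * F - [:\<beta>:] * G) * [:t:]"
    unfolding eq by (rule regroup)
  also have "\<dots> = [:0, 1:] * (A' * F + B' * G + D' * [:t:])"
    unfolding A' B' D' by (simp only: algebra_simps)
  finally have "h = A' * F + B' * G + D' * [:t:]" by (simp del: mult_pCons_left mult_pCons_right)
  then show ?thesis by (rule that)
qed

lemma nonzerodivisor_power_mod_three:
  fixes F G h :: "'a::idom poly" and t :: 'a
  assumes K: "koszul_exact (coeff F 0) (coeff G 0)"
    and nzd: "\<forall>C A B. t * C = A * coeff F 0 + B * coeff G 0 \<longrightarrow>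
      (\<exists>A' B'. C = A' * coeff F 0 + B' * coeff G 0)"
    and eq: "[:0, 1:] ^ m * h = A * F + B * G + D * [:t:]"
  shows "\<exists>A' B' D'. h = A' * F + B' * G + D' * [:t:]"
  using eq
proof (induction m arbitrary: A B D)
  case 0
  then show ?case by auto
next
  case (Suc m)
  then have "[:0, 1:] * ([:0, 1:] ^ m * h) = A * F + B * G + D * [:t:]" by (simp only: power_Suc mult.assoc)
  then obtain A' B' D' where "[:0, 1:] ^ m * h = A' * F + B' * G + D' * [:t:]"
    by (rule nonzerodivisor_mod_three[OF K nzd])
  then show ?case by (rule Suc.IH)
qed

text \<open>Every term of the binomial expansion contains \<open>a ^ m\<close> or
  \<open>b ^ n\<close>.\<close>

lemma add_power_split:
  fixes a b :: "'a::comm_ring_1"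
  shows "\<exists>P Q. (a + b) ^ (m + n) = a ^ m * P + b ^ n * Q"
proof (induction "m + n" arbitrary: m n)
  case 0
  then show ?case by (auto intro: exI[of _ 1] exI[of _ 0])
next
  case (Suc k)
  show ?case
  proof (cases "m = 0 \<or> n = 0")
    case True
    then show ?thesis
    proof
      assume "m = 0"
      then have "(a + b) ^ (m + n) = a ^ m * (a + b) ^ n + b ^ n * 0" by simp
      then show ?thesis by blast
    next
      assume "n = 0"
      then have "(a + b) ^ (m + n) = a ^ m * 0 + b ^ n * (a + b) ^ m" by simp
      then show ?thesis by blast
    qed
  next
    case False
    then obtain m' n' where mn: "m = Suc m'" "n = Suc n'" by (metis not0_implies_Suc)
    obtain P Q where 1: "(a + b) ^ (m' + n) = a ^ m' * P + b ^ n * Q" using Suc.hyps(1)[of m' n] Suc.hyps(2) mn by auto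
    obtain P' Q' where 2: "(a + b) ^ (m + n') = a ^ m * P' + b ^ n' * Q'" using Suc.hyps(1)[of m n'] Suc.hyps(2) mn by auto
    have "(a + b) ^ (m + n) = a * (a + b) ^ (m' + n) + b * (a + b) ^ (m + n')"
      by (simp add: mn algebra_simps)
    also have "\<dots> = a ^ m * (P + b * P') + b ^ n * (a * Q + Q')"
      unfolding 1 2 by (simp add: mn algebra_simps)
    finally show ?thesis by blast
  qed
qed

text \<open>The values along this curve are polynomial in z, so those at nonzero z determine the
  value at the origin. Setting \<open>y2\<close> and w to 0 means passing to coefficients 0, and
  \<open>y1\<close> is substituted by composition.\<close>

lemma eval4_along_curve:
  fixes D :: "'k::comm_ring_1 poly poly poly poly"
  obtains q where "\<And>z. poly q z = eval4 (e * z ^ \<alpha>) 0 z 0 D"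
proof -
  let ?\<Phi> = "\<lambda>f. pcompose (coeff f 0) (monom e \<alpha>)"
  have "poly (poly (map_poly ?\<Phi> D0) [:0, 1:]) z = eval3 (e * z ^ \<alpha>) 0 z D0" for D0 :: "'k poly poly poly" and z
  proof (induction D0)
    case (pCons a p)
    have "poly (?\<Phi> a) z = eval2 (e * z ^ \<alpha>) 0 a"
      by (simp add: poly_pcompose poly_monom poly_0_coeff_0 coeff_map_poly)
    then show ?case using pCons.IH by (simp add: Polynomial.map_poly_pCons)
  qed simp
  then show ?thesis using that[of "poly (map_poly ?\<Phi> (coeff D 0)) [:0, 1:]"]
    by (simp add: poly_0_coeff_0 coeff_map_poly)
qed

lemma ring_ideal_power_mono:
  assumes "ring_ideal I" "x ^ N \<in> I" "N \<le> n"
  shows "x ^ n \<in> I"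
  using ring_ideal_mult[OF assms(1,2), of "x ^ (n - N)"] assms(3) by (simp flip: power_add)

lemma finite_roots_of_unity:
  assumes "d > 0"
  shows "finite {e :: 'k::field. e ^ d = 1}"
proof -
  have "coeff (monom 1 d - 1 :: 'k poly) d = 1" using assms by simp
  then have "monom 1 d - 1 \<noteq> (0 :: 'k poly)" by force
  then have "finite {e :: 'k. poly (monom 1 d - 1) e = 0}" by (rule poly_roots_finite)
  then show ?thesis by (simp add: poly_monom)
qed

lemma prod_root_of_unity_eq_0:
  fixes e x :: "'k::field"
  assumes "d > 0" "e ^ d = 1" "e \<noteq> 1"
  shows "(\<Prod>e'\<in>{e. e ^ d = 1} - {1}. e * x - e' * x) = 0"
  using assms finite_roots_of_unity[OF assms(1), where 'k = 'k] by (intro prod_zero) auto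

lemma prod_one_minus_roots_of_unity:
  fixes x :: "'k::field"
  shows "(\<Prod>e\<in>{e. e ^ d = 1} - {1}. x - e * x) =
    (\<Prod>e\<in>{e :: 'k. e ^ d = 1} - {1}. 1 - e) * x ^ card ({e :: 'k. e ^ d = 1} - {1})"
proof -
  have "(\<Prod>e\<in>{e :: 'k. e ^ d = 1} - {1}. x - e * x) = (\<Prod>e\<in>{e. e ^ d = 1} - {1}. (1 - e) * x)"
    by (intro prod.cong) (simp_all add: algebra_simps)
  then show ?thesis by (simp add: prod.distrib)
qed

text \<open>Let \<open>I = (F, G)\<close>. A function that is 1 on one surface and 0 on the others extends to a polynomial
  after multiplication by powers of \<open>z\<close> and of \<open>w\<close>: there are \<open>s = I1 + J1\<close> and \<open>t = I2 + J2\<close>, a power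
  of \<open>z\<close> and of \<open>w\<close> up to constants, where \<open>I1 J2\<close> and \<open>I2 J1\<close> belong to \<open>I\<close>. Thus \<open>t I1 - s I2\<close>
  is in \<open>I\<close>. Since \<open>F, G, z, w\<close> is a regular sequence, the function itself is a polynomial modulo \<open>I\<close>,
  which is absurd at the common point of the surfaces.\<close>

theorem surfaces_meeting_in_point_not_two_equations:
  fixes F G :: "'k::alg_closed_field poly poly poly poly" and M :: "('k \<times> 'k) set"
  assumes pos: "d > 0" "\<alpha> > 0" "\<beta> > 0"
    and zero: "\<And>y1 y2 z w. eval4 y1 y2 z w F = 0 \<and> eval4 y1 y2 z w G = 0 \<longleftrightarrow>
      (\<exists>(e1, e2)\<in>M. y1 = e1 * z ^ \<alpha> \<and> y2 = e2 * w ^ \<beta>)"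
    and M1: "(1, 1) \<in> M"
    and M2: "\<And>e1 e2. (e1, e2) \<in> M \<Longrightarrow> e1 ^ d = 1 \<and> e2 ^ d = 1 \<and> (e1 = 1 \<longleftrightarrow> e2 = 1)"
    and M3: "(\<epsilon>1, \<epsilon>2) \<in> M" "\<epsilon>1 \<noteq> 1"
  shows False
proof -
  interpret e2: comm_ring_hom "eval2 y1 y2" for y1 y2 :: 'k by (rule comm_ring_hom_eval)
  interpret e3: comm_ring_hom "eval3 y1 y2 z" for y1 y2 z :: 'k by (rule comm_ring_hom_eval)
  interpret e4: comm_ring_hom "eval4 y1 y2 z w" for y1 y2 z w :: 'k by (rule comm_ring_hom_eval)
  have coeff0: "eval4 y1 y2 z 0 D = eval3 y1 y2 z (coeff D 0)" "eval3 y1 y2 0 H = eval2 y1 y2 (coeff H 0)"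
    for y1 y2 z :: 'k and D H
    by (simp_all add: poly_0_coeff_0 coeff_map_poly)
  have zero': "y1 ^ d = (z ^ \<alpha>) ^ d \<and> y2 ^ d = (w ^ \<beta>) ^ d"
    if "eval4 y1 y2 z w F = 0" "eval4 y1 y2 z w G = 0" for y1 y2 z w
    using iffD1[OF zero conjI[OF that]] M2 by (auto simp: power_mult_distrib)
  \<comment> \<open>In the plane z = w = 0 the common zeros reduce to the origin, so a common
    divisor has at most one zero and must be constant.\<close>
  have "koszul_exact (coeff (coeff F 0) 0) (coeff (coeff G 0) 0)"
  proof (rule koszul_exact_if_no_common_divisor)
    fix h assume h: "h dvd coeff (coeff F 0) 0" "h dvd coeff (coeff G 0) 0"
    have "y1 \<in> {0} \<and> y2 \<in> {0}" if "eval2 y1 y2 h = 0" for y1 y2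
    proof -
      have "eval2 y1 y2 (coeff (coeff F 0) 0) = 0" "eval2 y1 y2 (coeff (coeff G 0) 0) = 0"
        using h that by (auto elim!: dvdE simp: e2.hom_mult)
      then have "eval4 y1 y2 0 0 F = 0" "eval4 y1 y2 0 0 G = 0"
        unfolding coeff0(1) unfolding coeff0(2) by simp_all
      from zero'[OF this] show ?thesis using pos by (simp add: zero_power)
    qed
    then obtain c where c: "h = [:[:c:]:]" "c \<noteq> 0" by (rule const_if_few_zeros2[rotated 2]) auto
    have "h * [:[:inverse c:]:] = 1" using c by simp
    then show "h dvd 1" by (metis dvdI)
  qed
  note K2 = this
  \<comment> \<open>In the space w = 0 all common zeros lie on the curves \<open>y2 = 0\<close>,
    \<open>y1 ^ d = (z ^ \<alpha>) ^ d\<close>, so a common divisor defines no surface.\<close>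
  have K3: "koszul_exact (coeff F 0) (coeff G 0)"
  proof (rule koszul_exact_if_no_common_divisor)
    fix h assume h: "h dvd coeff F 0" "h dvd coeff G 0"
    have "y2 = 0 \<and> y1 ^ d = (z ^ \<alpha>) ^ d" if "eval3 y1 y2 z h = 0" for y1 y2 z
    proof -
      have "eval4 y1 y2 z 0 F = 0" "eval4 y1 y2 z 0 G = 0"
        unfolding coeff0(1) using h that by (auto elim!: dvdE simp: e3.hom_mult)
      from zero'[OF this] show ?thesis using pos by (simp add: zero_power)
    qed
    then obtain c where c: "h = [:[:[:c:]:]:]" "c \<noteq> 0" by (rule const_if_few_zeros3[OF pos(1,2)])
    have "h * [:[:[:inverse c:]:]:] = 1" using c by simp
    then show "h dvd 1" by (metis dvdI)
  qed

  define U where "U = {e :: 'k. e ^ d = 1} - {1}"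
  have U: "finite U" using finite_roots_of_unity[OF pos(1)] by (simp add: U_def)
  define con :: "'k \<Rightarrow> 'k poly poly poly poly" where "con c = [:[:[:[:c:]:]:]:]" for c
  define Y1 :: "'k poly poly poly poly" where "Y1 = [:[:[:[:0, 1:]:]:]:]"
  define Y2 :: "'k poly poly poly poly" where "Y2 = [:[:[:0, 1:]:]:]"
  define Z :: "'k poly poly poly poly" where "Z = [:[:0, 1:]:]"
  define W :: "'k poly poly poly poly" where "W = [:0, 1:]"
  have ev [simp]: "eval4 y1 y2 z w (con c) = c" "eval4 y1 y2 z w Y1 = y1" "eval4 y1 y2 z w Y2 = y2"
    "eval4 y1 y2 z w Z = z" "eval4 y1 y2 z w W = w" for y1 y2 z w c
    by (simp_all add: con_def Y1_def Y2_def Z_def W_def poly_map_poly_pCons)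
  define c where "c = (\<Prod>e\<in>U. 1 - e)"
  define m where "m = card U"
  have c0: "c \<noteq> 0" using U by (auto simp: c_def U_def)
  \<comment> \<open>\<open>i1\<close> vanishes on the surfaces with a nontrivial first root. On the
    surface (1, 1) it equals \<open>c * (z ^ \<alpha>) ^ m\<close>, so that \<open>j1\<close>
    vanishes there. The pair \<open>i2\<close>, \<open>j2\<close> does the same by means of
    \<open>y2\<close> and w.\<close>
  define i1 where "i1 = (\<Prod>e\<in>U. Y1 - con e * Z ^ \<alpha>)"
  define j1 where "j1 = con c * (Z ^ \<alpha>) ^ m - i1"
  define i2 where "i2 = (\<Prod>e\<in>U. Y2 - con e * W ^ \<beta>)"
  define j2 where "j2 = con c * (W ^ \<beta>) ^ m - i2"
  have ev_i1: "eval4 y1 y2 z w i1 = (\<Prod>e\<in>U. y1 - e * z ^ \<alpha>)" for y1 y2 z w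
    by (simp add: i1_def e4.hom_prod e4.hom_minus e4.hom_mult e4.hom_power)
  have ev_i2: "eval4 y1 y2 z w i2 = (\<Prod>e\<in>U. y2 - e * w ^ \<beta>)" for y1 y2 z w
    by (simp add: i2_def e4.hom_prod e4.hom_minus e4.hom_mult e4.hom_power)
  have ev_j1: "eval4 y1 y2 z w j1 = c * (z ^ \<alpha>) ^ m - eval4 y1 y2 z w i1" for y1 y2 z w
    by (simp add: j1_def e4.hom_minus e4.hom_mult e4.hom_power)
  have ev_j2: "eval4 y1 y2 z w j2 = c * (w ^ \<beta>) ^ m - eval4 y1 y2 z w i2" for y1 y2 z w
    by (simp add: j2_def e4.hom_minus e4.hom_mult e4.hom_power)
  have one: "(\<Prod>e\<in>U. x - e * x) = c * x ^ m" for x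
    using prod_one_minus_roots_of_unity[of x d] by (simp add: c_def m_def U_def)
  have i1_0: "eval4 (e * z ^ \<alpha>) y2 z w i1 = 0" if "e ^ d = 1" "e \<noteq> 1" for e y2 z w
    unfolding ev_i1 U_def using prod_root_of_unity_eq_0[OF pos(1) that] .
  have i2_0: "eval4 y1 (e * w ^ \<beta>) z w i2 = 0" if "e ^ d = 1" "e \<noteq> 1" for e y1 z w
    unfolding ev_i2 U_def using prod_root_of_unity_eq_0[OF pos(1) that] .
  have j1_0: "eval4 (z ^ \<alpha>) y2 z w j1 = 0" for y2 z w unfolding ev_j1 ev_i1 one by simp
  have j2_0: "eval4 y1 (w ^ \<beta>) z w j2 = 0" for y1 z w unfolding ev_j2 ev_i2 one by simp

  define I where "I = {A * F + B * G | A B. True}"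
  have I: "ring_ideal I"
    unfolding ring_ideal_def
  proof (intro conjI ballI allI)
    have "0 = 0 * F + 0 * G" by simp
    then show "0 \<in> I" unfolding I_def by blast
  next
    fix x y assume "x \<in> I" "y \<in> I"
    then obtain A B A' B' where "x = A * F + B * G" "y = A' * F + B' * G" unfolding I_def by blast
    then have "x + y = (A + A') * F + (B + B') * G" by (simp add: algebra_simps)
    then show "x + y \<in> I" unfolding I_def by blast
  next
    fix x r assume "x \<in> I"
    then obtain A B where "x = A * F + B * G" unfolding I_def by blast
    then have "r * x = (r * A) * F + (r * B) * G" by (simp add: algebra_simps)
    then show "r * x \<in> I" unfolding I_def by blast
  qed
  have FI: "F \<in> I" and GI: "G \<in> I"
  proof -
    have "F = 1 * F + 0 * G" "G = 0 * F + 1 * G" by simp_all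
    then show "F \<in> I" "G \<in> I" unfolding I_def by blast+
  qed
  have null: "\<exists>N. h ^ N \<in> I"
    if h: "\<And>e1 e2 z w. (e1, e2) \<in> M \<Longrightarrow> eval4 (e1 * z ^ \<alpha>) (e2 * w ^ \<beta>) z w h = 0" for h
  proof (rule nullstellensatz4[OF I])
    fix y1 y2 z w assume "\<And>f. f \<in> I \<Longrightarrow> eval4 y1 y2 z w f = 0"
    then have "eval4 y1 y2 z w F = 0 \<and> eval4 y1 y2 z w G = 0" using FI GI by blast
    then obtain e1 e2 where "(e1, e2) \<in> M" "y1 = e1 * z ^ \<alpha>" "y2 = e2 * w ^ \<beta>" using zero by blast
    then show "eval4 y1 y2 z w h = 0" using h by blast
  qed
  have "eval4 (e1 * z ^ \<alpha>) (e2 * w ^ \<beta>) z w (i1 * j2) = 0"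
    "eval4 (e1 * z ^ \<alpha>) (e2 * w ^ \<beta>) z w (j1 * i2) = 0" if "(e1, e2) \<in> M" for e1 e2 z w
  proof -
    have "e1 ^ d = 1" "e2 ^ d = 1" "e1 = 1 \<longleftrightarrow> e2 = 1" using M2[OF that] by auto
    then have "e1 = 1 \<and> e2 = 1 \<or>
        eval4 (e1 * z ^ \<alpha>) (e2 * w ^ \<beta>) z w i1 = 0 \<and> eval4 (e1 * z ^ \<alpha>) (e2 * w ^ \<beta>) z w i2 = 0"
      using i1_0 i2_0 by blast
    then show "eval4 (e1 * z ^ \<alpha>) (e2 * w ^ \<beta>) z w (i1 * j2) = 0"
      "eval4 (e1 * z ^ \<alpha>) (e2 * w ^ \<beta>) z w (j1 * i2) = 0"
      unfolding e4.hom_mult using j1_0 j2_0 by fastforce+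
  qed
  then obtain N1 N2 where N: "(i1 * j2) ^ N1 \<in> I" "(j1 * i2) ^ N2 \<in> I" using null by meson
  \<comment> \<open>A common exponent for both powers, and positive, so that \<open>i1 ^ n\<close>
    and \<open>j1 ^ n\<close> vanish wherever \<open>i1\<close> and \<open>j1\<close> do.\<close>
  define n where "n = Suc (N1 + N2)"
  have n: "(i1 * j2) ^ n \<in> I" "(j1 * i2) ^ n \<in> I"
    using ring_ideal_power_mono[OF I N(1), of n] ring_ideal_power_mono[OF I N(2), of n] by (simp_all add: n_def)
  \<comment> \<open>Only powers of the mixed products are known to lie in \<open>I\<close>. The two
    parts of this splitting are multiples of \<open>i1 ^ n\<close> and \<open>j1 ^ n\<close>, so
    their mixed products with the parts of the next splitting do lie in \<open>I\<close>.\<close>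
  obtain P1 Q1 where s: "(i1 + j1) ^ (n + n) = i1 ^ n * P1 + j1 ^ n * Q1" using add_power_split by blast
  obtain P2 Q2 where t: "(i2 + j2) ^ (n + n) = i2 ^ n * P2 + j2 ^ n * Q2" using add_power_split by blast
  have sum1: "i1 + j1 = con c * (Z ^ \<alpha>) ^ m" and sum2: "i2 + j2 = con c * (W ^ \<beta>) ^ m"
    by (simp_all add: j1_def j2_def)
  define c' where "c' = c ^ (n + n)"
  define k where "k = m * (n + n)"
  have c'0: "c' \<noteq> 0" using c0 by (simp add: c'_def)
  have con_power: "con x ^ r = con (x ^ r)" for x r
    by (simp add: con_def poly_const_pow)
  have s': "i1 ^ n * P1 + j1 ^ n * Q1 = con c' * Z ^ (\<alpha> * k)"
    unfolding s[symmetric] unfolding sum1 by (simp add: power_mult_distrib con_power c'_def k_def mult.assoc flip: power_mult)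
  have t': "i2 ^ n * P2 + j2 ^ n * Q2 = con c' * W ^ (\<beta> * k)"
    unfolding t[symmetric] unfolding sum2 by (simp add: power_mult_distrib con_power c'_def k_def mult.assoc flip: power_mult)
  have "(con c' * W ^ (\<beta> * k)) * (i1 ^ n * P1) - (con c' * Z ^ (\<alpha> * k)) * (i2 ^ n * P2) =
      (P1 * Q2) * (i1 * j2) ^ n - (Q1 * P2) * (j1 * i2) ^ n"
    unfolding s'[symmetric] t'[symmetric] power_mult_distrib by (simp add: algebra_simps)
  also have "\<dots> \<in> I" using n I by (intro ring_ideal_diff ring_ideal_mult)
  finally obtain A B where
    "(con c' * W ^ (\<beta> * k)) * (i1 ^ n * P1) - (con c' * Z ^ (\<alpha> * k)) * (i2 ^ n * P2) = A * F + B * G"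
    unfolding I_def by blast
  then have "W ^ (\<beta> * k) * (con c' * (i1 ^ n * P1)) = A * F + B * G + (con c' * (i2 ^ n * P2)) * Z ^ (\<alpha> * k)"
    by (simp add: algebra_simps)
  moreover have "Z ^ (\<alpha> * k) = [:[:0, 1:] ^ (\<alpha> * k):]" by (simp add: Z_def poly_const_pow)
  ultimately have "[:0, 1:] ^ (\<beta> * k) * (con c' * (i1 ^ n * P1)) =
      A * F + B * G + (con c' * (i2 ^ n * P2)) * [:[:0, 1:] ^ (\<alpha> * k):]" by (simp only: W_def)
  \<comment> \<open>The power of w is cancelled modulo \<open>F\<close>, \<open>G\<close> and the
    power of z. The resulting \<open>D\<close> is, up to a constant, the quotient of the first part
    of the splitting by the power of z: the function that separates the surface (1, 1) from the
    others.\<close>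
  from nonzerodivisor_power_mod_three[OF K3 _ this]
  obtain A' B' D where "con c' * (i1 ^ n * P1) = A' * F + B' * G + D * [:[:0, 1:] ^ (\<alpha> * k):]"
    using nonzerodivisor_power_mod_two[OF K2] by blast
  then have D: "con c' * (i1 ^ n * P1) = A' * F + B' * G + D * Z ^ (\<alpha> * k)"
    by (simp add: Z_def poly_const_pow)

  have on_zero: "c' * eval4 y1 y2 z w (i1 ^ n * P1) = eval4 y1 y2 z w D * z ^ (\<alpha> * k)"
    if "eval4 y1 y2 z w F = 0 \<and> eval4 y1 y2 z w G = 0" for y1 y2 z w
    using arg_cong[OF D, of "eval4 y1 y2 z w"] that
    by (simp add: e4.hom_add e4.hom_mult e4.hom_power)
  have on_surface: "c' * eval4 (e1 * z ^ \<alpha>) 0 z 0 (i1 ^ n * P1) = eval4 (e1 * z ^ \<alpha>) 0 z 0 D * z ^ (\<alpha> * k)"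
    if "(e1, e2) \<in> M" for e1 e2 z
  proof (rule on_zero)
    have "0 = e2 * 0 ^ \<beta>" using pos by simp
    then show "eval4 (e1 * z ^ \<alpha>) 0 z 0 F = 0 \<and> eval4 (e1 * z ^ \<alpha>) 0 z 0 G = 0"
      using zero that by blast
  qed
  have if_j1_0: "eval4 y1 y2 z w (i1 ^ n * P1) = c' * z ^ (\<alpha> * k)" if "eval4 y1 y2 z w j1 = 0" for y1 y2 z w
    using arg_cong[OF s', of "eval4 y1 y2 z w"] that
    by (simp add: e4.hom_add e4.hom_mult e4.hom_power n_def)
  have if_i1_0: "eval4 y1 y2 z w (i1 ^ n * P1) = 0" if "eval4 y1 y2 z w i1 = 0" for y1 y2 z w
    using that by (simp add: e4.hom_mult e4.hom_power n_def)
  have D1: "eval4 (1 * z ^ \<alpha>) 0 z 0 D = c' * c'" if "z \<noteq> 0" for z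
  proof -
    have "eval4 (1 * z ^ \<alpha>) 0 z 0 j1 = 0" using j1_0 by (simp only: mult_1)
    from on_surface[OF M1, of z, unfolded if_j1_0[OF this]] that show ?thesis by simp
  qed
  have De: "eval4 (\<epsilon>1 * z ^ \<alpha>) 0 z 0 D = 0" if "z \<noteq> 0" for z
  proof -
    have "eval4 (\<epsilon>1 * z ^ \<alpha>) 0 z 0 i1 = 0" using M2[OF M3(1)] M3(2) by (intro i1_0) auto
    from on_surface[OF M3(1), of z, unfolded if_i1_0[OF this]] that show ?thesis by simp
  qed
  obtain q where q: "\<And>z. poly q z = eval4 (1 * z ^ \<alpha>) 0 z 0 D" using eval4_along_curve by blast
  obtain r where r: "\<And>z. poly r z = eval4 (\<epsilon>1 * z ^ \<alpha>) 0 z 0 D" using eval4_along_curve by blast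
  \<comment> \<open>On the line of nonzero z the values of \<open>D\<close> are constant,
    \<open>c' * c'\<close> on one surface and 0 on the other; as polynomials in z they keep these
    values at z = 0, where the two curves meet.\<close>
  have "q - [:c' * c':] = 0" by (rule poly_eq_0_if_cofinitely[of "{0}"]) (use q D1 in auto)
  moreover have "r = 0" by (rule poly_eq_0_if_cofinitely[of "{0}"]) (use r De in auto)
  moreover have "poly q 0 = poly r 0" unfolding q r using pos by (simp add: zero_power)
  ultimately show False using c'0 by simp
qed

section \<open>Arithmetical rank\<close>

text \<open>The zero polynomial pads a smaller set to a pair; the two inclusions ensure that the
  zero set is unchanged.\<close>

lemma card_le_two_subset:
  assumes "finite F" "card F \<le> 2" "0 \<in> S" "F \<subseteq> S"
  shows "\<exists>f\<in>S. \<exists>g\<in>S. F \<subseteq> {f, g} \<and> {f, g} \<subseteq> insert 0 F"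
proof -
  consider "card F = 0" | "card F = 1" | "card F = 2" using assms(2) by linarith
  then show ?thesis
  proof cases
    case 1
    then show ?thesis using assms by auto
  next
    case 2
    then obtain f where "F = {f}" by (auto simp: card_1_singleton_iff)
    then show ?thesis using assms by auto
  next
    case 3
    then obtain f g where "F = {f, g}" by (auto simp: card_2_iff)
    then show ?thesis using assms by auto
  qed
qed

lemma root_of_unity_coprime_power_eq_1:
  fixes x :: "'k::comm_monoid_mult"
  assumes "x ^ d = 1" "gcd d k = 1" "x ^ k = 1"
  shows "x = 1"
proof -
  have "Rings.coprime k d" using assms(2) by (simp add: coprime_iff_gcd_eq_1 gcd.commute)
  then obtain s where "[k * s = 1] (mod d)" using cong_solve_coprime_nat by auto
  then have "x ^ (k * s) = x ^ 1" by (rule root_of_unity_power_cong[OF assms(1)])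
  then show ?thesis by (simp add: power_mult assms(3))
qed

lemma exists_root_of_unity:
  assumes "prime p" "p dvd d" "CHAR('k::alg_closed_field) \<noteq> p"
  obtains \<zeta> :: "'k::alg_closed_field" where "\<zeta> ^ d = 1" "\<zeta> \<noteq> 1"
proof -
  \<comment> \<open>A root of 1 + x + ... + x^(p - 1) is a \<open>p\<close>-th root of unity, and it
    is not 1 because the value at 1 is \<open>p\<close>, which is nonzero in the field.\<close>
  define q :: "'k poly" where "q = (\<Sum>i<p. monom 1 i)"
  have p: "p \<ge> 2" using assms(1) by (rule prime_ge_2_nat)
  have "coeff q 1 = (\<Sum>i<p. if i = 1 then 1 else 0)" by (simp add: q_def coeff_sum)
  also have "\<dots> = 1" using p by simp
  finally have "degree q > 0" using le_degree[of q 1] by simp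
  then obtain \<zeta> where "poly q \<zeta> = 0" using alg_closed_imp_poly_has_root by blast
  then have \<zeta>: "(\<Sum>i<p. \<zeta> ^ i) = 0" by (simp add: q_def poly_sum poly_monom)
  have "\<zeta> \<noteq> 1"
  proof
    assume "\<zeta> = 1"
    then have "of_nat p = (0 :: 'k)" using \<zeta> by simp
    then have "CHAR('k) dvd p" by (simp add: of_nat_eq_0_iff_char_dvd)
    then have "CHAR('k) = 1" using assms(1,3) by (metis prime_nat_iff)
    then show False by (metis of_nat_CHAR of_nat_1 one_neq_zero)
  qed
  moreover have "\<zeta> ^ p - 1 = 0" using \<zeta> by (simp add: power_diff_1_eq)
  then have "\<zeta> ^ d = 1" using assms(2) by (auto elim!: dvdE simp: power_mult)
  ultimately show ?thesis using that by blast
qed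

text \<open>Setting all x-coordinates to 1 leaves a plane that meets \<open>V\<close> in finitely
  many points, among them (1, 1), whereas one equation would cut out the empty set or an infinite
  set.\<close>

lemma toric_variety_not_hypersurface:
  fixes V :: "(nat \<Rightarrow> 'k::alg_closed_field) set"
  assumes V: "V = simplicial_toric_variety n d a b" and d: "d > 0"
    and f: "f \<in> mpoly_ring (n + 2)"
  shows "zero_set (n + 2) {f} \<noteq> V"
proof
  assume eq: "zero_set (n + 2) {f} = V"
  define pt where "pt y1 y2 = (\<lambda>m\<in>{1..n+2}. if m = n + 1 then y1 else if m = n + 2 then y2 else 1)" for y1 y2 :: 'k
  define H where "H = subst_mpoly (\<lambda>c. [:[:c:]:])
    (\<lambda>m. if m = n + 1 then [:[:0, 1:]:] else if m = n + 2 then [:0, 1:] else 1) f"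
  interpret e2: comm_ring_hom "eval2 y1 y2" for y1 y2 :: 'k by (rule comm_ring_hom_eval)
  have H: "eval2 y1 y2 H = eval_mpoly (pt y1 y2) f" for y1 y2
    unfolding H_def
    by (rule hom_subst_mpoly[OF comm_ring_hom_eval(2) _ f]) (simp_all add: pt_def poly_map_poly_pCons)
  have aff: "pt y1 y2 \<in> affine_space (n + 2)" for y1 y2 by (simp add: pt_def affine_space_def)
  have fin: "finite {y :: 'k. y ^ d = 1}" by (rule finite_roots_of_unity[OF d])
  have "y1 \<in> {y. y ^ d = 1} \<and> y2 \<in> {y. y ^ d = 1}" if "eval2 y1 y2 H = 0" for y1 y2
  proof -
    have "pt y1 y2 \<in> simplicial_toric_variety n d a b"
      using that aff eq V by (auto simp: H zero_set_def)
    from toric_variety_satisfies_binomial_equations[OF this] show ?thesis by (simp add: pt_def)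
  qed
  then obtain c where c: "H = [:[:c:]:]" "c \<noteq> 0" by (rule const_if_few_zeros2[OF fin fin])
  have "pt 1 1 \<in> V"
    unfolding V by (rule toric_varietyI[of _ n "\<lambda>_. 1"]) (simp_all add: pt_def affine_space_def)
  then have "eval_mpoly (pt 1 1) f = 0" by (simp add: eq[symmetric] zero_set_def)
  then have "eval2 1 1 H = 0" by (simp only: H)
  then show False using c(2) by (simp add: c(1) poly_map_poly_pCons)
qed

lemma toric_variety_not_two_equations:
  fixes V :: "(nat \<Rightarrow> 'k::alg_closed_field) set"
  assumes V: "V = simplicial_toric_variety n d a b" and d: "d > 1"
    and cong: "gcd d c = 1" "\<And>k. k \<in> {1..n} \<Longrightarrow> [b k = c * a k] (mod d)"
    and l: "l \<in> {1..n}" "gcd d (a l) = 1"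
    and i: "i \<in> {1..n}" "a i = 0" "b i \<noteq> 0" "d dvd b i"
    and j: "j \<in> {1..n}" "b j = 0" "a j \<noteq> 0" "d dvd a j"
    and \<zeta>: "\<zeta> ^ d = (1 :: 'k)" "\<zeta> \<noteq> 1"
    and f: "f \<in> mpoly_ring (n + 2)" and g: "g \<in> mpoly_ring (n + 2)"
  shows "zero_set (n + 2) {f, g} \<noteq> V"
proof
  assume eq: "zero_set (n + 2) {f, g} = V"
  obtain \<alpha> where \<alpha>: "a j = d * \<alpha>" using j(4) by blast
  obtain \<beta> where \<beta>: "b i = d * \<beta>" using i(4) by blast
  have pos: "d > 0" "\<alpha> > 0" "\<beta> > 0" using d i(3) j(3) \<alpha> \<beta> by (auto intro!: Nat.gr0I)
  have ij: "i \<noteq> j" using i(2) j(3) by auto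
  \<comment> \<open>Keeping \<open>l\<close> in \<open>R\<close> leaves its root of unity free;
    \<open>gcd d 0 = d > 1\<close> excludes \<open>l = i\<close>.\<close>
  have li: "l \<noteq> i" using l(2) i(2) d by auto
  have "gcd d (a j) = d" using j(4) by (simp add: gcd_nat.absorb1)
  then have lj: "l \<noteq> j" using l(2) d by auto
  define R where "R = {1..n} - {i, j}"
  have split: "(\<Prod>k=1..n. h k) = h i * h j * (\<Prod>k\<in>R. h k)" for h :: "nat \<Rightarrow> 'k"
  proof -
    have "(\<Prod>k=1..n. h k) = h i * (\<Prod>k\<in>{1..n} - {i}. h k)" using i(1) by (simp add: prod.remove)
    also have "(\<Prod>k\<in>{1..n} - {i}. h k) = h j * (\<Prod>k\<in>{1..n} - {i} - {j}. h k)"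
      using j(1) ij by (intro prod.remove) auto
    also have "{1..n} - {i} - {j} = R" by (auto simp: R_def)
    finally show ?thesis by (simp add: mult.assoc)
  qed
  \<comment> \<open>The values of the two monomials when the parameters in \<open>R\<close>, whose
    \<open>d\<close>-th powers are 1 on the slice, run through the roots of unity.\<close>
  define M where "M = {((\<Prod>k\<in>R. \<epsilon> k ^ a k), (\<Prod>k\<in>R. \<epsilon> k ^ b k)) | \<epsilon>. \<forall>k. \<epsilon> k ^ d = (1 :: 'k)}"
  define pt where "pt y1 y2 z w = (\<lambda>m\<in>{1..n+2}. if m = n + 1 then y1 else if m = n + 2 then y2
    else if m = j then z else if m = i then w else 1)" for y1 y2 z w :: 'k
  have aff: "pt y1 y2 z w \<in> affine_space (n + 2)" for y1 y2 z w by (simp add: pt_def affine_space_def)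
  have pt_simps: "pt y1 y2 z w j = z" "pt y1 y2 z w i = w" "pt y1 y2 z w (n + 1) = y1" "pt y1 y2 z w (n + 2) = y2"
    "\<And>k. k \<in> R \<Longrightarrow> pt y1 y2 z w k = 1" for y1 y2 z w
    using i(1) j(1) ij by (auto simp: pt_def R_def)
  have pt_V: "pt y1 y2 z w \<in> V \<longleftrightarrow> (\<exists>(e1, e2)\<in>M. y1 = e1 * z ^ \<alpha> \<and> y2 = e2 * w ^ \<beta>)" for y1 y2 z w
  proof
    assume "pt y1 y2 z w \<in> V"
    then obtain u where u: "\<And>k. k \<in> {1..n} \<Longrightarrow> pt y1 y2 z w k = u k ^ d"
      "pt y1 y2 z w (n + 1) = (\<Prod>k=1..n. u k ^ a k)" "pt y1 y2 z w (n + 2) = (\<Prod>k=1..n. u k ^ b k)"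
      unfolding V by (rule toric_varietyE) blast
    define \<epsilon> where "\<epsilon> k = (if k \<in> R then u k else 1)" for k
    have "u k ^ d = 1" if "k \<in> R" for k
      using u(1)[of k] that pt_simps(5)[OF that] by (simp add: R_def)
    then have \<epsilon>: "\<forall>k. \<epsilon> k ^ d = 1" by (simp add: \<epsilon>_def)
    have prod: "(\<Prod>k\<in>R. \<epsilon> k ^ e k) = (\<Prod>k\<in>R. u k ^ e k)" for e
      by (intro prod.cong) (auto simp: \<epsilon>_def)
    have "u j ^ (d * \<alpha>) = z ^ \<alpha>" "u i ^ (d * \<beta>) = w ^ \<beta>"
      using u(1)[OF j(1)] u(1)[OF i(1)] by (simp_all add: pt_simps power_mult)
    then have "y1 = (\<Prod>k\<in>R. \<epsilon> k ^ a k) * z ^ \<alpha>" "y2 = (\<Prod>k\<in>R. \<epsilon> k ^ b k) * w ^ \<beta>"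
      using u(2,3) unfolding pt_simps split prod i(2) j(2) \<alpha> \<beta>
      by (simp_all only: power_0 mult_1_left mult_1_right mult.commute)
    then show "\<exists>(e1, e2)\<in>M. y1 = e1 * z ^ \<alpha> \<and> y2 = e2 * w ^ \<beta>" using \<epsilon> unfolding M_def by blast
  next
    assume "\<exists>(e1, e2)\<in>M. y1 = e1 * z ^ \<alpha> \<and> y2 = e2 * w ^ \<beta>"
    then obtain \<epsilon> where \<epsilon>: "\<And>k. \<epsilon> k ^ d = 1"
      and y: "y1 = (\<Prod>k\<in>R. \<epsilon> k ^ a k) * z ^ \<alpha>" "y2 = (\<Prod>k\<in>R. \<epsilon> k ^ b k) * w ^ \<beta>"
      unfolding M_def by blast
    obtain z' w' where zw: "z' ^ d = z" "w' ^ d = w" using nth_root_exists[OF pos(1)] by metis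
    have pow: "z' ^ (d * \<alpha>) = z ^ \<alpha>" "w' ^ (d * \<beta>) = w ^ \<beta>" by (simp_all add: power_mult zw)
    define u where "u k = (if k = j then z' else if k = i then w' else \<epsilon> k)" for k
    have uij: "u j = z'" "u i = w'" using ij by (simp_all add: u_def)
    have prod: "(\<Prod>k\<in>R. u k ^ e k) = (\<Prod>k\<in>R. \<epsilon> k ^ e k)" for e
      by (intro prod.cong) (auto simp: u_def R_def)
    show "pt y1 y2 z w \<in> V"
      unfolding V
    proof (rule toric_varietyI[where u = u, OF aff])
      fix k assume k: "k \<in> {1..n}"
      consider "k = j" | "k = i" | "k \<in> R" using k by (auto simp: R_def)
      then show "pt y1 y2 z w k = u k ^ d"
      proof cases
        case 3
        then have "u k = \<epsilon> k" by (auto simp: u_def R_def)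
        then show ?thesis using 3 \<epsilon> by (simp add: pt_simps)
      qed (simp_all add: pt_simps uij zw)
    next
      show "pt y1 y2 z w (n + 1) = (\<Prod>k=1..n. u k ^ a k)"
        unfolding pt_simps split prod uij i(2) \<alpha> y(1) pow by simp
      show "pt y1 y2 z w (n + 2) = (\<Prod>k=1..n. u k ^ b k)"
        unfolding pt_simps split prod uij j(2) \<beta> y(2) pow by simp
    qed
  qed
  define X where "X m = (if m = n + 1 then [:[:[:[:0, 1:]:]:]:] else if m = n + 2 then [:[:[:0, 1:]:]:]
    else if m = j then [:[:0, 1:]:] else if m = i then [:0, 1:] else 1 :: 'k poly poly poly poly)" for m
  have slice: "eval4 y1 y2 z w (subst_mpoly (\<lambda>c. [:[:[:[:c:]:]:]:]) X h) = eval_mpoly (pt y1 y2 z w) h"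
    if h: "h \<in> mpoly_ring (n + 2)" for h y1 y2 z w
  proof (rule hom_subst_mpoly[OF comm_ring_hom_eval(4) _ h])
    interpret e2: comm_ring_hom "eval2 y1 y2" for y1 y2 :: 'k by (rule comm_ring_hom_eval)
    interpret e3: comm_ring_hom "eval3 y1 y2 z" for y1 y2 z :: 'k by (rule comm_ring_hom_eval)
    interpret e4: comm_ring_hom "eval4 y1 y2 z w" for y1 y2 z w :: 'k by (rule comm_ring_hom_eval)
    show "eval4 y1 y2 z w [:[:[:[:c:]:]:]:] = c" for c
      by (simp add: poly_map_poly_pCons)
    show "eval4 y1 y2 z w (X k) = pt y1 y2 z w k" if "k \<in> {1..n + 2}" for k
      using that by (simp add: X_def pt_def poly_map_poly_pCons)
  qed
  show False
  proof (rule surfaces_meeting_in_point_not_two_equations[OF pos])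
    let ?F = "subst_mpoly (\<lambda>c. [:[:[:[:c:]:]:]:]) X f" and ?G = "subst_mpoly (\<lambda>c. [:[:[:[:c:]:]:]:]) X g"
    show "eval4 y1 y2 z w ?F = 0 \<and> eval4 y1 y2 z w ?G = 0 \<longleftrightarrow>
      (\<exists>(e1, e2)\<in>M. y1 = e1 * z ^ \<alpha> \<and> y2 = e2 * w ^ \<beta>)" for y1 y2 z w
      unfolding slice[OF f] slice[OF g] pt_V[symmetric] eq[symmetric] using aff by (simp add: zero_set_def)
    show "(1, 1) \<in> M" unfolding M_def by (auto intro!: exI[of _ "\<lambda>_. 1"])
    show "e1 ^ d = 1 \<and> e2 ^ d = 1 \<and> (e1 = 1 \<longleftrightarrow> e2 = 1)" if eM: "(e1, e2) \<in> M" for e1 e2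
    proof -
      obtain \<epsilon> where \<epsilon>: "\<And>k. \<epsilon> k ^ d = 1" and e: "e1 = (\<Prod>k\<in>R. \<epsilon> k ^ a k)" "e2 = (\<Prod>k\<in>R. \<epsilon> k ^ b k)"
        using eM unfolding M_def by blast
      have 1: "e1 ^ d = 1" "e2 ^ d = 1" unfolding e by (simp_all add: prod_power_commute \<epsilon>)
      \<comment> \<open>Proportionality modulo \<open>d\<close> makes the second root the power
        \<open>c\<close> of the first; as \<open>c\<close> is prime to \<open>d\<close>, one is
        trivial exactly if the other is.\<close>
      have "e2 = (\<Prod>k\<in>R. \<epsilon> k ^ (a k * c))"
        unfolding e(2)
      proof (rule prod.cong)
        fix k assume "k \<in> R"
        then have "[b k = a k * c] (mod d)" using cong(2)[of k] by (simp add: R_def mult.commute)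
        then show "\<epsilon> k ^ b k = \<epsilon> k ^ (a k * c)" by (rule root_of_unity_power_cong[OF \<epsilon>])
      qed simp
      then have "e2 = e1 ^ c" by (simp add: e(1) power_mult prod_power_distrib)
      then show ?thesis using 1 root_of_unity_coprime_power_eq_1[OF 1(1) cong(1)] by auto
    qed
    \<comment> \<open>A nontrivial root at \<open>l\<close> alone: \<open>a l\<close> is prime to
      \<open>d\<close>, so \<open>\<zeta> ^ a l\<close> is still nontrivial.\<close>
    define \<epsilon> where "\<epsilon> k = (if k = l then \<zeta> else 1)" for k
    show "((\<Prod>k\<in>R. \<epsilon> k ^ a k), (\<Prod>k\<in>R. \<epsilon> k ^ b k)) \<in> M"
      unfolding M_def using \<zeta>(1) by (auto simp: \<epsilon>_def)
    have "(\<Prod>k\<in>R. \<epsilon> k ^ a k) = (\<Prod>k\<in>{l}. \<epsilon> k ^ a k)"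
      using l(1) li lj by (intro prod.mono_neutral_right) (auto simp: R_def \<epsilon>_def)
    then show "(\<Prod>k\<in>R. \<epsilon> k ^ a k) \<noteq> 1"
      using root_of_unity_coprime_power_eq_1[OF \<zeta>(1) l(2)] \<zeta>(2) by (auto simp: \<epsilon>_def)
  qed
qed

section \<open>Bounds for the arithmetical rank\<close>

lemma ara_le: "finite F \<Longrightarrow> F \<subseteq> mpoly_ring N \<Longrightarrow> zero_set N F = V \<Longrightarrow> card F \<le> k \<Longrightarrow> ara N V \<le> enat k"
  unfolding ara_def by (rule order_trans[OF Inf_lower[of "enat (card F)"]]) auto

lemma ara_ge:
  assumes "\<And>F. finite F \<Longrightarrow> F \<subseteq> mpoly_ring N \<Longrightarrow> zero_set N F = V \<Longrightarrow> k \<le> card F"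
  shows "enat k \<le> ara N V"
  unfolding ara_def using assms by (intro Inf_greatest) auto

lemma zero_set_insert_zero: "zero_set N (insert 0 F) = zero_set N F"
  by (auto simp: zero_set_def eval_mpoly_zero)

lemma zero_set_antimono: "F \<subseteq> G \<Longrightarrow> zero_set N G \<subseteq> zero_set N F"
  by (auto simp: zero_set_def)

lemma ara_toric_ge_two:
  fixes V :: "(nat \<Rightarrow> 'k::alg_closed_field) set"
  assumes "V = simplicial_toric_variety n d a b" "d > 0"
  shows "2 \<le> ara (n + 2) V"
proof -
  have "enat 2 \<le> ara (n + 2) V"
  proof (rule ara_ge, rule ccontr)
    fix F :: "'k mpoly set"
    assume F: "finite F" "F \<subseteq> mpoly_ring (n + 2)" "zero_set (n + 2) F = V" and "\<not> 2 \<le> card F"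
    then consider "F = {}" | f where "F = {f}"
      using card_1_singleton_iff[of F] by (cases "card F") auto
    then obtain f where "f \<in> mpoly_ring (n + 2)" "zero_set (n + 2) {f} = V"
    proof cases
      case 1
      then show ?thesis using that[of 0] F(3) zero_set_insert_zero[of "n + 2" "{} :: 'k mpoly set"]
        by (simp add: mpoly_ring_zero)
    qed (use F that in auto)
    then show False using toric_variety_not_hypersurface[OF assms] by blast
  qed
  then show ?thesis by (simp add: numeral_eq_enat)
qed

theorem corollary1:
  fixes n d p :: nat and a b :: "nat \<Rightarrow> nat"
    and V :: "(nat \<Rightarrow> 'k::alg_closed_field) set"
  assumes n_pos: "n > 0"
    and d_gt_1: "d > 1"
    and nonzero: "\<And>i. i \<in> {1..n} \<Longrightarrow> a i \<noteq> 0 \<or> b i \<noteq> 0"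
    and gcd_1: "Gcd (insert d (a ` {1..n} \<union> b ` {1..n})) = 1"
    and V: "V = simplicial_toric_variety n d a b"
    and A: "\<exists>i \<in> {1..n}. \<exists>j \<in> {1..n}. a i = 0 \<and> b i \<noteq> 0 \<and> a j \<noteq> 0 \<and> b j = 0"
    and B1: "\<And>i. i \<in> {1..n} \<Longrightarrow> d dvd a i \<longleftrightarrow> d dvd b i"
    and B2: "\<And>i. i \<in> {1..n} \<Longrightarrow>
      (\<not> d dvd a i \<longleftrightarrow> gcd d (a i) = 1) \<and> (\<not> d dvd b i \<longleftrightarrow> gcd d (b i) = 1)"
    and C: "proportional_rows_mod n d a b"
    and D: "\<exists>i \<in> {1..n}. gcd d (a i) = 1"
    and p: "prime p" "p dvd d"
  shows "(CHAR('k) \<noteq> p \<longrightarrow> ara (n + 2) V = 3) \<and>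
    ((\<exists>r > 0. d = p ^ r) \<longrightarrow>
       (CHAR('k) = p \<longrightarrow> ara (n + 2) V = 2) \<and>
       (set_theoretic_complete_intersection (n + 2) V \<longleftrightarrow> CHAR('k) = p))"
proof -
  have d: "d > 0" using d_gt_1 by simp
  obtain l where l: "l \<in> {1..n}" "gcd d (a l) = 1" by (rule bexE[OF D])
  then have bl: "gcd d (b l) = 1" using B1[OF l(1)] B2[OF l(1)] by metis
  obtain c where c: "gcd d c = 1" "\<And>i. i \<in> {1..n} \<Longrightarrow> [b i = c * a i] (mod d)"
    using proportional_rows_mod_coprime[OF d_gt_1 C l bl] by metis
  obtain F where F: "finite F" "card F \<le> 3" "F \<subseteq> mpoly_ring (n + 2)" "zero_set (n + 2) F = V"
    by (rule toric_variety_three_equations[OF V d nonzero c(2) l bl])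
  \<comment> \<open>The lower bound for the dimension presupposes that \<open>V\<close> is closed;
    the three equations show this in every characteristic.\<close>
  have "algebraic_set (n + 2) V" using algebraic_set_zero_set[OF F(3)] F(4) by simp
  then have codim: "alg_codim (n + 2) V = 2" by (rule alg_codim_toric[OF V _ d])
  have three: "ara (n + 2) V = 3" if char: "CHAR('k) \<noteq> p"
  proof (rule antisym)
    show "ara (n + 2) V \<le> 3" using ara_le[OF F(1,3,4,2)] by (simp add: numeral_eq_enat)
    obtain \<zeta> :: 'k where \<zeta>: "\<zeta> ^ d = 1" "\<zeta> \<noteq> 1" by (rule exists_root_of_unity[OF p char])
    obtain i j where i: "i \<in> {1..n}" "a i = 0" "b i \<noteq> 0" and j: "j \<in> {1..n}" "b j = 0" "a j \<noteq> 0"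
      using A by blast
    have dvd: "d dvd b i" "d dvd a j" using B1[OF i(1)] B1[OF j(1)] i(2) j(2) by simp_all
    have "enat 3 \<le> ara (n + 2) V"
    proof (rule ara_ge, rule ccontr)
      fix F :: "'k mpoly set"
      assume F: "finite F" "F \<subseteq> mpoly_ring (n + 2)" "zero_set (n + 2) F = V" and "\<not> 3 \<le> card F"
      then obtain f g where fg: "f \<in> mpoly_ring (n + 2)" "g \<in> mpoly_ring (n + 2)"
        "F \<subseteq> {f, g}" "{f, g} \<subseteq> insert 0 F"
        using card_le_two_subset[OF F(1) _ mpoly_ring_zero F(2)] by auto
      have "zero_set (n + 2) {f, g} = V"
        using zero_set_antimono[OF fg(3), of "n + 2"] zero_set_antimono[OF fg(4), of "n + 2"] F(3)
        by (simp add: zero_set_insert_zero)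
      then show False
        using toric_variety_not_two_equations[OF V d_gt_1 c l i dvd(1) j dvd(2) \<zeta> fg(1,2)] by blast
    qed
    then show "3 \<le> ara (n + 2) V" by (simp add: numeral_eq_enat)
  qed
  have two: "ara (n + 2) V = 2" if "CHAR('k) = p" "d = p ^ r" for r
  proof (rule antisym)
    have char: "prime CHAR('k)" "d = CHAR('k) ^ r" using p(1) that by simp_all
    obtain F where "finite F" "card F \<le> 2" "F \<subseteq> mpoly_ring (n + 2)" "zero_set (n + 2) F = V"
      by (rule toric_variety_two_equations[OF V char])
    then show "ara (n + 2) V \<le> 2" using ara_le[of F "n + 2" V 2] by (simp add: numeral_eq_enat)
    show "2 \<le> ara (n + 2) V" by (rule ara_toric_ge_two[OF V d])
  qed
  \<comment> \<open>This separates the rank 3 from the codimension 2 when the characteristic is not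
    \<open>p\<close>, which gives the remaining direction of the equivalence.\<close>
  have "(2 :: enat) \<noteq> 3" by simp
  then show ?thesis
    using three two unfolding set_theoretic_complete_intersection_def codim by metis
qed

end
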